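(* Neither of the Shintani zeta functions $\xi^{+}(s)$, $\xi^{-}(s)$ admits a representation as a finite sum of Euler products. That is, for each choice of sign $\pm$, writing $\xi^{\pm}(s) = \sum_{n \geq 1} a^{\pm}(n) n^{-s}$, there do not exist a positive integer $k$, real numbers $c_1, \dots, c_k$, and multiplicative functions $b_1, \dots, b_k$ on the positive integers such that $a^{\pm}(n) = \sum_{i=1}^k c_i b_i(n)$ for all $n \geq 1$.
   Context: Let $V_{\mathbb{Z}} = \{ a u^3 + b u^2 v + c u v^2 + d v^3 : a,b,c,d \in \mathbb{Z}\}$ be the lattice of integral binary cubic forms. The discriminant of $f = a u^3 + b u^2 v + c u v^2 + d v^3$ is $\mathrm{Disc}(f) = b^2c^2 - 4ac^3 - 4b^3 d - 27 a^2 d^2 + 18abcd$. The group $\mathrm{GL}_2(\mathbb{Z})$ (and hence $\mathrm{SL}_2(\mathbb{Z})$) acts on $V_{\mathbb{Z}}$ by $(\gamma \cdot f)(u,v) = \frac{1}{\det \gamma} f((u,v)\cdot \gamma)$; this action preserves the discriminant. The Shintani zeta functions are the Dirichlet series $$\xi^{\pm}(s) = \sum_{\substack{x \in \mathrm{SL}_2(\mathbb{Z}) \backslash V_{\mathbb{Z}} \\ \pm \mathrm{Disc}(x) > 0}} \frac{1}{|\mathrm{Stab}(x)|}\, |\mathrm{Disc}(x)|^{-s},$$ where the sum is over $\mathrm{SL}_2(\mathbb{Z})$-orbits and $\mathrm{Stab}(x)$ is the stabilizer of (a representative of) $x$ in $\mathrm{SL}_2(\mathbb{Z})$. Thus the coefficient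 is $a^{\pm}(n) = \sum 1/|\mathrm{Stab}(x)|$ over orbits $x$ with $\mathrm{Disc}(x) = \pm n$. A multiplicative function is a (complex-valued) function $b$ on the positive integers with $b(1) = 1$ and $b(mn) = b(m)b(n)$ whenever $\gcd(m,n)=1$. *)

theory Defs
  imports "HOL-Analysis.Analysis" "HOL-Algebra.Group_Action"
begin

section \<open>Integral binary cubic forms\<close>

text \<open>\<open>Cubic a b c d\<close> stands for a u^3 + b u^2 v + c u v^2 + d v^3, so the lattice of all
  integral binary cubic forms is the universe of this type.\<close>

datatype cubic = Cubic int int int int

fun cubic_eval :: "cubic \<Rightarrow> int^2 \<Rightarrow> int" where
  "cubic_eval (Cubic a b c d) w =
     a * (w$1)^3 + b * (w$1)^2 * w$2 + c * w$1 * (w$2)^2 + d * (w$2)^3"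

fun cubic_disc :: "cubic \<Rightarrow> int" where
  "cubic_disc (Cubic a b c d) =
     b^2 * c^2 - 4 * a * c^3 - 4 * b^3 * d - 27 * a^2 * d^2 + 18 * a * b * c * d"

lemma cubic_eval_inject:
  assumes "\<And>w. cubic_eval f w = cubic_eval g w"
  shows "f = g"
proof -
  obtain a b c d where f: "f = Cubic a b c d" by (cases f)
  obtain a' b' c' d' where g: "g = Cubic a' b' c' d'" by (cases g)
  have "cubic_eval f (vector [x, y]) = cubic_eval g (vector [x, y])" for x y
    by (rule assms)
  from this[of 1 0] this[of 0 1] this[of 1 1] this[of 1 "-1"]
  show ?thesis by (simp add: f g vector_2)
qed

text \<open>The coefficients of (1 / det g) f((u,v) g), where (u,v) is a row vector. For g in GL_2(Z)
  the determinant is 1 or -1, so 1 / det g = det g; see \<open>cubic_eval_act\<close>.\<close>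

fun cubic_act :: "int^2^2 \<Rightarrow> cubic \<Rightarrow> cubic" where
  "cubic_act g (Cubic a b c d) =
    (let p = g$1$1; q = g$1$2; r = g$2$1; s = g$2$2 in
     Cubic
      (det g * (a * p^3 + b * p^2 * q + c * p * q^2 + d * q^3))
      (det g * (3 * a * p^2 * r + b * (p^2 * s + 2 * p * q * r)
                + c * (2 * p * q * s + q^2 * r) + 3 * d * q^2 * s))
      (det g * (3 * a * p * r^2 + b * (2 * p * r * s + q * r^2)
                + c * (p * s^2 + 2 * q * r * s) + 3 * d * q * s^2))
      (det g * (a * r^3 + b * r^2 * s + c * r * s^2 + d * s^3)))"

lemma cubic_eval_act: "cubic_eval (cubic_act g f) w = det g * cubic_eval f (w v* g)"
  by (cases f)
    (simp add: Let_def vector_matrix_mult_def sum_2 algebra_simps power2_eq_square power3_eq_cube)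

lemma cubic_act_mult: "cubic_act (g ** h) f = cubic_act g (cubic_act h f)"
  by (rule cubic_eval_inject) (simp add: cubic_eval_act det_mul vector_matrix_mul_assoc)

lemma cubic_act_one: "cubic_act (mat 1) f = f"
  by (rule cubic_eval_inject) (simp add: cubic_eval_act)

lemma cubic_disc_act:
  assumes "(det g)\<^sup>2 = 1"
  shows "cubic_disc (cubic_act g f) = cubic_disc f"
proof -
  obtain a b c d where f: "f = Cubic a b c d" by (cases f)
  have det: "det g = g$1$1 * g$2$2 - g$1$2 * g$2$1" by (simp add: det_2)
  have "cubic_disc (cubic_act g f)
      = (det g)^4 * (g$1$1 * g$2$2 - g$1$2 * g$2$1)^6 * cubic_disc f"
    unfolding f cubic_act.simps Let_def cubic_disc.simps by algebra
  also have "\<dots> = ((det g)\<^sup>2)^5 * cubic_disc f"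
    unfolding det[symmetric] by algebra
  finally show ?thesis using assms by simp
qed


section \<open>SL_2(Z) and its orbits\<close>

definition SL2Z :: "(int^2^2) monoid" where
  "SL2Z = \<lparr>carrier = {g. det g = 1}, mult = (**), one = mat 1\<rparr>"

lemma group_SL2Z: "group SL2Z"
proof (rule groupI)
  fix g assume g: "g \<in> carrier SL2Z"
  define h :: "int^2^2" where "h = vector [vector [g$2$2, - g$1$2], vector [- g$2$1, g$1$1]]"
  have "det g = 1" using g by (simp add: SL2Z_def)
  then have "det h = 1" "h ** g = mat 1"
    by (auto simp: h_def det_2 vec_eq_iff forall_2 matrix_matrix_mult_def sum_2 mat_def vector_2
        algebra_simps)
  then show "\<exists>h\<in>carrier SL2Z. h \<otimes>\<^bsub>SL2Z\<^esub> g = \<one>\<^bsub>SL2Z\<^esub>"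
    by (auto simp: SL2Z_def)
qed (auto simp: SL2Z_def det_mul matrix_mul_assoc)

lemma group_action_cubic_act: "group_action SL2Z (UNIV :: cubic set) cubic_act"
proof -
  interpret group SL2Z by (rule group_SL2Z)
  have bij: "cubic_act g \<in> Bij UNIV" if g: "g \<in> carrier SL2Z" for g
  proof -
    define h where "h = inv\<^bsub>SL2Z\<^esub> g"
    have "h ** g = mat 1" "g ** h = mat 1"
      using l_inv[OF g] r_inv[OF g] by (simp_all add: h_def SL2Z_def)
    then have "cubic_act h (cubic_act g f) = f" "cubic_act g (cubic_act h f) = f" for f
      by (simp_all add: cubic_act_mult[symmetric] cubic_act_one)
    then have "bij (cubic_act g)" by (metis bijI')
    then show ?thesis by (simp add: Bij_def)
  qed
  have "cubic_act \<in> hom SL2Z (BijGroup UNIV)"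
    using bij
    by (auto simp: hom_def BijGroup_def compose_def SL2Z_def cubic_act_mult fun_eq_iff)
  then show ?thesis
    unfolding group_action_def
    by (intro group_hom.intro group_hom_axioms.intro group_SL2Z group_BijGroup)
qed


section \<open>Coefficients of the Shintani zeta functions\<close>

text \<open>\<open>shintani_coeff 1 n\<close> and \<open>shintani_coeff (-1) n\<close> are the coefficients of n^(-s) in the
  Shintani zeta functions of positive and of negative discriminant. For nonzero discriminant there
  are finitely many orbits and all stabilizers are finite, so the sum and the cardinality have
  their usual meaning; neither the discriminant nor the order of the stabilizer depends on the
  representative of the orbit (\<open>cubic_disc_act\<close>, \<open>card_stabilizer_act\<close>).\<close>

definition shintani_coeff :: "int \<Rightarrow> nat \<Rightarrow> real" where
  "shintani_coeff \<epsilon> n =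
     (\<Sum>X \<in> {X \<in> orbits SL2Z UNIV cubic_act. \<forall>f\<in>X. cubic_disc f = \<epsilon> * int n}.
        1 / real (card (stabilizer SL2Z cubic_act (SOME f. f \<in> X))))"

lemma card_stabilizer_act:
  assumes g: "g \<in> carrier SL2Z"
  shows "card (stabilizer SL2Z cubic_act (cubic_act g f)) = card (stabilizer SL2Z cubic_act f)"
proof -
  interpret group SL2Z by (rule group_SL2Z)
  define h where "h = inv\<^bsub>SL2Z\<^esub> g"
  have h: "h \<in> carrier SL2Z" using g by (simp add: h_def)
  have gh: "h ** g = mat 1" "g ** h = mat 1"
    using l_inv[OF g] r_inv[OF g] by (simp_all add: h_def SL2Z_def)
  have cancel: "cubic_act h (cubic_act g x) = x" for x
    by (simp add: cubic_act_mult[symmetric] cubic_act_one gh)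
  have "bij_betw (\<lambda>x. g ** x ** h) (stabilizer SL2Z cubic_act f)
          (stabilizer SL2Z cubic_act (cubic_act g f))"
  proof (rule bij_betw_byWitness[where f' = "\<lambda>x. h ** x ** g"])
    have "h ** (g ** x ** h) ** g = x" "g ** (h ** x ** g) ** h = x" for x
      by (metis gh matrix_mul_assoc matrix_mul_lid matrix_mul_rid)+
    then show "\<forall>x\<in>stabilizer SL2Z cubic_act f. h ** (g ** x ** h) ** g = x"
      "\<forall>x\<in>stabilizer SL2Z cubic_act (cubic_act g f). g ** (h ** x ** g) ** h = x"
      by auto
  qed (use g h in \<open>auto simp: stabilizer_def SL2Z_def det_mul cubic_act_mult cancel[unfolded SL2Z_def]\<close>)
  then show ?thesis by (metis bij_betw_same_card)
qed

text \<open>Values at 0 are irrelevant: these are functions on the positive integers.\<close>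

definition multiplicative_fun :: "(nat \<Rightarrow> complex) \<Rightarrow> bool" where
  "multiplicative_fun b \<longleftrightarrow>
     b 1 = 1 \<and> (\<forall>m n. m > 0 \<longrightarrow> n > 0 \<longrightarrow> coprime m n \<longrightarrow> b (m * n) = b m * b n)"

end

theory Submission
  imports Defs "HOL-Number_Theory.Cong" "HOL-Computational_Algebra.Fundamental_Theorem_Algebra"
begin

text \<open>Suppose that the coefficients \<open>a(n)\<close> were \<open>\<Sum>l\<le>k. c\<^sub>l b\<^sub>l(n)\<close> with multiplicative \<open>b\<^sub>l\<close>. For primes
\<open>p\<^sub>0, \<dots>, p\<^sub>k\<close> and positive integers \<open>n\<^sub>0, \<dots>, n\<^sub>k\<close> such that no \<open>p\<^sub>i\<close> divides any \<open>n\<^sub>j\<close>, the matrix with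
entries \<open>M\<^sub>i\<^sub>j = a(p\<^sub>i\<^sup>2 n\<^sub>j) - a(n\<^sub>j) = \<Sum>l. c\<^sub>l (b\<^sub>l(p\<^sub>i\<^sup>2) - 1) b\<^sub>l(n\<^sub>j)\<close> has rank at most \<open>k\<close>. The
contradiction comes from a choice of the \<open>p\<^sub>i\<close> and \<open>n\<^sub>j\<close> for which \<open>M\<close> is triangular of size \<open>k + 1\<close> with
nonzero diagonal (\<open>triangular_family_exists\<close>).

Put \<open>D = \<epsilon> n\<close> and let \<open>p\<close> be a prime that does not divide \<open>6 D\<close>. Think of a cubic form as a cubic ring
with a basis. A form of discriminant \<open>p\<^sup>2 D\<close> then belongs either to a subring of index \<open>p\<close> in a
ring of discriminant \<open>D\<close>, or to a ring that is totally ramified at \<open>p\<close>. The subrings of index \<open>p\<close> of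
the ring of \<open>f\<close> correspond to the roots of \<open>f\<close> modulo \<open>p\<close> on the projective line. This gives two cases.

\<^item> Let \<open>D\<close> be a quadratic nonresidue and \<open>-3\<close> a square modulo \<open>p\<close>. Every form of discriminant \<open>D\<close> has
  exactly one root modulo \<open>p\<close> (\<open>nonresidue_has_root\<close>, \<open>root_unique\<close>), and total ramification would
  make \<open>D\<close> equal to \<open>-3\<close> times a square. Hence \<open>a(p\<^sup>2 n) = a(n)\<close> (\<open>disc_mass_nonresidue\<close>).

\<^item> Let \<open>D\<close> be a square modulo \<open>p\<close>, congruent to 1 modulo 4 but not a square, and suppose that
  every form of discriminant \<open>D\<close> has a root modulo \<open>p\<close>. Then each class of discriminant \<open>D\<close> yields at least one
  class of discriminant \<open>p\<^sup>2 D\<close>, and the form \<open>u\<^sup>2v + uv\<^sup>2 + dv\<^sup>3\<close> with \<open>1 - 4d = D\<close> yields at least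
  two. Hence \<open>a(p\<^sup>2 n) > a(n)\<close> (\<open>disc_mass_split\<close>).

Primes of the second kind, even with \<open>-3\<close> a square modulo \<open>p\<close>, exist for every such \<open>D\<close>: there are finitely many
classes of discriminant \<open>D\<close> (\<open>finite_disc_orbits\<close>), and finitely many polynomials have a common prime
modulo which all of them have roots, namely a prime with a factor of degree one in a number field
that contains a root of each polynomial (\<open>common_prime_with_roots\<close>). So one chooses in turn \<open>n\<^sub>j\<close>, by the
Chinese remainder theorem, such that \<open>\<epsilon> n\<^sub>j\<close> is a nonresidue modulo all \<open>p\<^sub>i\<close> with \<open>i < j\<close>, and then
\<open>p\<^sub>j\<close> of the second kind for \<open>\<epsilon> n\<^sub>j\<close>. This gives \<open>M\<^sub>i\<^sub>j = 0\<close> for \<open>i < j\<close> and \<open>M\<^sub>j\<^sub>j > 0\<close>.\<close>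

section \<open>Primes modulo which given polynomials have roots\<close>

locale subfield_of =
  fixes K :: "'a :: field_char_0 set"
  assumes one_mem: "1 \<in> K"
    and diff_mem: "x \<in> K \<Longrightarrow> y \<in> K \<Longrightarrow> x - y \<in> K"
    and mult_mem: "x \<in> K \<Longrightarrow> y \<in> K \<Longrightarrow> x * y \<in> K"
    and inverse_mem: "x \<in> K \<Longrightarrow> inverse x \<in> K"

definition polys_over :: "'a :: field_char_0 set \<Rightarrow> 'a poly set" where
  "polys_over K = {p. \<forall>n. coeff p n \<in> K}"

definition adjoin :: "'a :: field_char_0 set \<Rightarrow> 'a \<Rightarrow> 'a set" where
  "adjoin K x = (\<lambda>p. poly p x) ` polys_over K"

definition algebraic_over :: "'a :: field_char_0 set \<Rightarrow> 'a \<Rightarrow> bool" where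
  "algebraic_over K x \<longleftrightarrow> (\<exists>p\<in>polys_over K. p \<noteq> 0 \<and> poly p x = 0)"

lemma subfield_of_Rats: "subfield_of (\<rat> :: 'a :: field_char_0 set)"
  by standard auto

context subfield_of
begin

lemma zero_mem: "0 \<in> K"
  using diff_mem[OF one_mem one_mem] by simp

lemma uminus_mem: "x \<in> K \<Longrightarrow> - x \<in> K"
  using diff_mem[OF zero_mem] by fastforce

lemma add_mem: "x \<in> K \<Longrightarrow> y \<in> K \<Longrightarrow> x + y \<in> K"
  using diff_mem[OF _ uminus_mem] by fastforce

lemma divide_mem: "x \<in> K \<Longrightarrow> y \<in> K \<Longrightarrow> x / y \<in> K"
  unfolding divide_inverse by (intro mult_mem inverse_mem)

lemma sum_mem: "(\<And>i. i \<in> A \<Longrightarrow> f i \<in> K) \<Longrightarrow> sum f A \<in> K"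
  by (induction A rule: infinite_finite_induct) (auto intro: zero_mem add_mem)

lemma power_mem: "x \<in> K \<Longrightarrow> x ^ n \<in> K"
  by (induction n) (auto intro: one_mem mult_mem)

lemma of_nat_mem: "of_nat n \<in> K"
  by (induction n) (auto intro: zero_mem one_mem add_mem)

lemma polys_over_0: "0 \<in> polys_over K"
  by (simp add: polys_over_def zero_mem)

lemma polys_over_const: "c \<in> K \<Longrightarrow> [:c:] \<in> polys_over K"
  by (auto simp: polys_over_def coeff_pCons zero_mem split: nat.splits)

lemma polys_over_pCons: "c \<in> K \<Longrightarrow> p \<in> polys_over K \<Longrightarrow> pCons c p \<in> polys_over K"
  by (auto simp: polys_over_def coeff_pCons split: nat.splits)

lemma polys_over_pCons_iff: "pCons c p \<in> polys_over K \<longleftrightarrow> c \<in> K \<and> p \<in> polys_over K"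
  by (force simp: polys_over_def coeff_pCons split: nat.splits)

lemma polys_over_add: "p \<in> polys_over K \<Longrightarrow> q \<in> polys_over K \<Longrightarrow> p + q \<in> polys_over K"
  by (auto simp: polys_over_def add_mem)

lemma polys_over_diff: "p \<in> polys_over K \<Longrightarrow> q \<in> polys_over K \<Longrightarrow> p - q \<in> polys_over K"
  by (auto simp: polys_over_def diff_mem)

lemma polys_over_mult: "p \<in> polys_over K \<Longrightarrow> q \<in> polys_over K \<Longrightarrow> p * q \<in> polys_over K"
  by (auto simp: polys_over_def coeff_mult intro!: sum_mem mult_mem)

lemma polys_over_monom: "c \<in> K \<Longrightarrow> monom c n \<in> polys_over K"
  by (auto simp: polys_over_def zero_mem)

lemma polys_over_pcompose:
  "p \<in> polys_over K \<Longrightarrow> q \<in> polys_over K \<Longrightarrow> pcompose p q \<in> polys_over K"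
  by (induction p)
    (auto simp: pcompose_pCons polys_over_pCons_iff polys_over_0
       intro!: polys_over_add polys_over_mult polys_over_const)

lemma polys_over_pderiv: "p \<in> polys_over K \<Longrightarrow> pderiv p \<in> polys_over K"
  by (auto simp: polys_over_def coeff_pderiv simp flip: of_nat_Suc intro!: mult_mem of_nat_mem)

lemma poly_mem: "p \<in> polys_over K \<Longrightarrow> x \<in> K \<Longrightarrow> poly p x \<in> K"
  by (auto simp: poly_altdef polys_over_def intro!: sum_mem mult_mem power_mem)

lemma polys_over_division:
  assumes "p \<in> polys_over K" "d \<in> polys_over K" "d \<noteq> 0"
  shows "\<exists>q\<in>polys_over K. \<exists>r\<in>polys_over K. p = d * q + r \<and> (r = 0 \<or> degree r < degree d)"
  using assms(1)
proof (induction "degree p" arbitrary: p rule: less_induct)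
  case less
  show ?case
  proof (cases "p = 0 \<or> degree p < degree d")
    case True
    then show ?thesis using less.prems by (intro bexI[of _ 0] bexI[of _ p]) (auto simp: polys_over_0)
  next
    case False
    define m where "m = monom (lead_coeff p / lead_coeff d) (degree p - degree d)"
    have m: "m \<in> polys_over K"
      using less.prems assms(2) unfolding m_def
      by (intro polys_over_monom divide_mem) (auto simp: polys_over_def)
    define p' where "p' = p - d * m"
    have p': "p' \<in> polys_over K"
      unfolding p'_def using less.prems assms(2) m by (intro polys_over_diff polys_over_mult)
    have lc: "lead_coeff p / lead_coeff d \<noteq> 0" using False assms(3) by auto
    have m0: "m \<noteq> 0" using lc by (simp add: m_def monom_eq_0_iff)
    have dm: "degree (d * m) = degree p"
      using False lc m0 assms(3) by (simp add: m_def degree_mult_eq degree_monom_eq)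
    have "lead_coeff (d * m) = lead_coeff p"
      using lc assms(3) unfolding lead_coeff_mult by (simp add: m_def degree_monom_eq)
    then have "coeff p' (degree p) = 0" unfolding p'_def using dm by simp
    moreover have "degree p' \<le> degree p" unfolding p'_def using dm by (metis degree_diff_le order_refl)
    ultimately have "p' = 0 \<or> degree p' < degree p"
      by (metis le_neq_implies_less leading_coeff_0_iff)
    then obtain q r where q: "q \<in> polys_over K" and r: "r \<in> polys_over K"
      and "p' = d * q + r" "r = 0 \<or> degree r < degree d"
      using less.hyps[of p'] p' polys_over_0 by (metis add_0_right mult_zero_right)
    then have "p = d * (q + m) + r \<and> (r = 0 \<or> degree r < degree d)"
      by (simp add: p'_def algebra_simps)
    then show ?thesis using q r m polys_over_add by blast
  qed
qed

lemma minimal_polynomial: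
  assumes "algebraic_over K x"
  obtains m where "m \<in> polys_over K" "m \<noteq> 0" "poly m x = 0" "degree m > 0"
    "\<And>p. p \<in> polys_over K \<Longrightarrow> poly p x = 0 \<Longrightarrow> \<exists>q\<in>polys_over K. p = m * q"
proof -
  define S where "S = {p \<in> polys_over K. p \<noteq> 0 \<and> poly p x = 0}"
  have "\<exists>p. p \<in> S" using assms by (auto simp: S_def algebraic_over_def)
  then obtain m where m: "m \<in> S" and min: "\<And>p. p \<in> S \<Longrightarrow> degree m \<le> degree p"
    using ex_has_least_nat[of "\<lambda>p. p \<in> S" _ degree] by blast
  have "\<exists>q\<in>polys_over K. p = m * q" if p: "p \<in> polys_over K" "poly p x = 0" for p
  proof -
    obtain q r where q: "q \<in> polys_over K" and r: "r \<in> polys_over K"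
      and e: "p = m * q + r" "r = 0 \<or> degree r < degree m"
      using polys_over_division[OF p(1), of m] m by (auto simp: S_def)
    have "poly r x = 0" using e(1) p(2) m by (auto simp: S_def)
    then have "r = 0" using min[of r] r e(2) by (cases "r = 0") (auto simp: S_def)
    then show ?thesis using q e by auto
  qed
  moreover have "degree m > 0"
    using m by (cases "degree m = 0") (auto simp: S_def elim!: degree_eq_zeroE)
  ultimately show ?thesis using that m by (auto simp: S_def)
qed

lemma mem_adjoin: "x \<in> adjoin K x"
  unfolding adjoin_def
  by (rule image_eqI[of _ _ "[:0, 1:]"]) (auto intro!: polys_over_pCons polys_over_0 zero_mem one_mem)

lemma subset_adjoin: "K \<subseteq> adjoin K x"
proof
  fix c assume "c \<in> K"
  then have "poly [:c:] x \<in> adjoin K x" unfolding adjoin_def by (intro imageI polys_over_const)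
  then show "c \<in> adjoin K x" by simp
qed

text \<open>Only inverses need an argument. Let \<open>m\<close> be the minimal polynomial of \<open>x\<close>, let
\<open>h(x) \<noteq> 0\<close>, and let \<open>e\<close> generate the ideal \<open>(h, m)\<close> of
\<open>K[X]\<close>. As \<open>e\<close> divides \<open>h\<close>, it does not vanish at \<open>x\<close>;
as it divides \<open>m\<close>, the cofactor does, so by minimality of \<open>m\<close> the polynomial
\<open>e\<close> is a constant \<open>u h + v m\<close>, and \<open>u\<close> gives the inverse of
\<open>h(x)\<close> up to that constant.\<close>

lemma subfield_of_adjoin:
  assumes "algebraic_over K x"
  shows "subfield_of (adjoin K x)"
proof
  show "1 \<in> adjoin K x" using subset_adjoin one_mem by blast
next
  fix a b assume "a \<in> adjoin K x" "b \<in> adjoin K x"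
  then obtain p q where pq: "p \<in> polys_over K" "q \<in> polys_over K" "a = poly p x" "b = poly q x"
    by (auto simp: adjoin_def)
  have "a - b = poly (p - q) x" "a * b = poly (p * q) x" using pq by auto
  moreover have "p - q \<in> polys_over K" "p * q \<in> polys_over K"
    using pq by (auto intro!: polys_over_diff polys_over_mult)
  ultimately show "a - b \<in> adjoin K x" "a * b \<in> adjoin K x"
    unfolding adjoin_def by blast+
next
  fix a assume "a \<in> adjoin K x"
  then obtain h where h: "h \<in> polys_over K" "a = poly h x" by (auto simp: adjoin_def)
  show "inverse a \<in> adjoin K x"
  proof (cases "a = 0")
    case True
    then show ?thesis using subset_adjoin zero_mem by auto
  next
    case False
    obtain m where m: "m \<in> polys_over K" "m \<noteq> 0" "poly m x = 0"
      and mdvd: "\<And>p. p \<in> polys_over K \<Longrightarrow> poly p x = 0 \<Longrightarrow> \<exists>q\<in>polys_over K. p = m * q"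
      using minimal_polynomial[OF assms] by metis
    define J where "J = {e. \<exists>u\<in>polys_over K. \<exists>v\<in>polys_over K. e = u * h + v * m}"
    have JK: "J \<subseteq> polys_over K"
      using h m by (auto simp: J_def intro!: polys_over_add polys_over_mult)
    have hJ: "h \<in> J" "m \<in> J"
      using polys_over_0 polys_over_const[OF one_mem]
      by (force simp: J_def one_pCons[symmetric])+
    have Jstep: "f - e * q \<in> J" if fe: "f \<in> J" "e \<in> J" "q \<in> polys_over K" for f e q
    proof -
      obtain u v where 1: "u \<in> polys_over K" "v \<in> polys_over K" "f = u * h + v * m"
        using fe(1) unfolding J_def by blast
      obtain u' v' where 2: "u' \<in> polys_over K" "v' \<in> polys_over K" "e = u' * h + v' * m"
        using fe(2) unfolding J_def by blast
      note * = 1 2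
      then have "f - e * q = (u - u' * q) * h + (v - v' * q) * m" by (simp add: algebra_simps)
      moreover have "u - u' * q \<in> polys_over K" "v - v' * q \<in> polys_over K"
        using * fe(3) by (auto intro!: polys_over_diff polys_over_mult)
      ultimately show ?thesis unfolding J_def by blast
    qed
    have "\<exists>e. e \<in> J \<and> e \<noteq> 0" using hJ m by blast
    then obtain e where e: "e \<in> J" "e \<noteq> 0"
      and min: "\<And>f. f \<in> J \<and> f \<noteq> 0 \<Longrightarrow> degree e \<le> degree f"
      using ex_has_least_nat[of "\<lambda>e. e \<in> J \<and> e \<noteq> 0" _ degree] by blast
    have edvd: "\<exists>q\<in>polys_over K. f = e * q" if f: "f \<in> J" for f
    proof -
      obtain q r where q: "q \<in> polys_over K" and r: "f = e * q + r" "r = 0 \<or> degree r < degree e"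
        using polys_over_division[of f e] f e JK by blast
      then have "r \<in> J" using Jstep[OF f e(1) q] by simp
      then have "r = 0" using min[of r] r(2) by (cases "r = 0") auto
      then show ?thesis using q r by auto
    qed
    obtain k where k: "k \<in> polys_over K" "m = e * k" using edvd[OF hJ(2)] by blast
    obtain k' where k': "h = e * k'" using edvd[OF hJ(1)] by blast
    have ex: "poly e x \<noteq> 0" using False h k' by auto
    then have "poly k x = 0" using k m by auto
    then obtain k2 where k2: "k = m * k2" using mdvd k by blast
    have "k \<noteq> 0" using k m by auto
    then have "degree m \<le> degree k" using k2 m by (auto simp: degree_mult_eq)
    moreover have "degree m = degree e + degree k"
      using k e \<open>k \<noteq> 0\<close> by (simp add: degree_mult_eq)
    ultimately have "degree e = 0" by simp
    then obtain c where c: "e = [:c:]" by (elim degree_eq_zeroE)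
    have cK: "c \<in> K" using e(1) JK c by (auto simp: polys_over_pCons_iff)
    obtain u v where uv: "u \<in> polys_over K" "e = u * h + v * m" using e by (auto simp: J_def)
    have "c = poly u x * a" using arg_cong[OF uv(2), of "\<lambda>p. poly p x"] c m h by simp
    moreover have "c \<noteq> 0" using c e by auto
    ultimately have "inverse a = poly (u * [:inverse c:]) x"
      using False by (simp add: field_simps)
    moreover have "u * [:inverse c:] \<in> polys_over K"
      using uv cK by (intro polys_over_mult polys_over_const inverse_mem)
    ultimately show ?thesis unfolding adjoin_def by blast
  qed
qed

end

lemma polys_over_mono: "K \<subseteq> L \<Longrightarrow> polys_over K \<subseteq> polys_over L"
  by (auto simp: polys_over_def)

lemma adjoin_subset:
  assumes "subfield_of L" "K \<subseteq> L" "x \<in> L"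
  shows "adjoin K x \<subseteq> L"
  using polys_over_mono[OF assms(2)] subfield_of.poly_mem[OF assms(1) _ assms(3)]
  by (auto simp: adjoin_def)

text \<open>The span of the finitely many products \<open>x\<^sup>i y\<^sup>j\<close> below the degrees of
\<open>x\<close> and \<open>y\<close> is closed under multiplication by \<open>x\<close> and by
\<open>y\<close>. It contains all powers of \<open>z = x + c y\<close>, so these are linearly dependent.\<close>

lemma algebraic_over_Rats_add_mult:
  fixes x y :: "'a :: field_char_0"
  assumes "algebraic_over \<rat> x" "algebraic_over \<rat> y"
  shows "algebraic_over \<rat> (x + of_nat c * y)"
proof -
  interpret Q: vector_space "\<lambda>(q::rat) (z::'a). of_rat q * z"
    by standard (auto simp: algebra_simps of_rat_add of_rat_mult)
  interpret R: subfield_of "\<rat> :: 'a set" by (rule subfield_of_Rats)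
  have top: "\<exists>n u. z ^ n = (\<Sum>i<n. of_rat (u i) * z ^ i)" if z: "algebraic_over \<rat> z" for z :: 'a
  proof -
    obtain p where p: "p \<in> polys_over \<rat>" "p \<noteq> 0" "poly p z = 0"
      using z by (auto simp: algebraic_over_def)
    have "\<forall>i. \<exists>u. - (coeff p i / lead_coeff p) = of_rat u"
      using p by (metis (no_types, lifting) polys_over_def mem_Collect_eq R.divide_mem R.uminus_mem Rats_cases)
    then obtain u where u: "\<And>i. of_rat (u i) = - (coeff p i / lead_coeff p)" by metis
    have "0 = (\<Sum>i<degree p. coeff p i * z ^ i) + lead_coeff p * z ^ degree p"
      using p(3) by (simp add: poly_altdef flip: lessThan_Suc_atMost)
    then have "z ^ degree p = - (\<Sum>i<degree p. coeff p i * z ^ i) / lead_coeff p"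
      using p(2) by (simp add: field_simps eq_neg_iff_add_eq_0)
    also have "\<dots> = (\<Sum>i<degree p. of_rat (u i) * z ^ i)"
      by (simp add: u sum_divide_distrib sum_negf)
    finally show ?thesis by blast
  qed
  obtain m u where u: "x ^ m = (\<Sum>i<m. of_rat (u i) * x ^ i)" using top assms by blast
  obtain n v where v: "y ^ n = (\<Sum>i<n. of_rat (v i) * y ^ i)" using top assms by blast
  define B where "B = (\<lambda>(i, j). x ^ i * y ^ j) ` ({..<m} \<times> {..<n})"
  define V where "V = Q.span B"
  have B: "x ^ i * y ^ j \<in> V" if "i < m" "j < n" for i j
    unfolding V_def B_def using that by (intro Q.span_base) auto
  have xV: "x * z \<in> V" if "z \<in> V" for z
    using that[unfolded V_def]
  proof (induction rule: Q.span_induct_alt)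
    case base
    show ?case by (simp add: V_def Q.span_zero)
  next
    case (step q b w)
    obtain i j where ij: "b = x ^ i * y ^ j" "i < m" "j < n" using step(1) by (auto simp: B_def)
    have "x * b \<in> V"
    proof (cases "Suc i < m")
      case True
      then show ?thesis using B[of "Suc i" j] ij by (simp add: mult.assoc)
    next
      case False
      then have "m = Suc i" using ij by simp
      then have "x * b = (\<Sum>i<m. of_rat (u i) * (x ^ i * y ^ j))"
        using u ij
        by (simp add: sum_distrib_right distrib_right mult.assoc flip: mult.assoc[of x])
      also have "\<dots> \<in> V"
        using B ij unfolding V_def by (intro Q.span_sum Q.span_scale) auto
      finally show ?thesis .
    qed
    then have "of_rat q * (x * b) + x * w \<in> V"
      using step unfolding V_def by (intro Q.span_add Q.span_scale)
    then show ?case by (simp add: algebra_simps)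
  qed
  have yV: "y * z \<in> V" if "z \<in> V" for z
    using that[unfolded V_def]
  proof (induction rule: Q.span_induct_alt)
    case base
    show ?case by (simp add: V_def Q.span_zero)
  next
    case (step q b w)
    obtain i j where ij: "b = x ^ i * y ^ j" "i < m" "j < n" using step(1) by (auto simp: B_def)
    have "y * b \<in> V"
    proof (cases "Suc j < n")
      case True
      then show ?thesis using B[of i "Suc j"] ij by (simp add: mult.left_commute)
    next
      case False
      then have "n = Suc j" using ij by simp
      then have "y * b = x ^ i * (y ^ n)" using ij by simp
      also have "\<dots> = (\<Sum>j<n. of_rat (v j) * (x ^ i * y ^ j))"
        unfolding v by (simp add: sum_distrib_left mult.left_commute)
      also have "\<dots> \<in> V"
        using B ij unfolding V_def by (intro Q.span_sum Q.span_scale) auto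
      finally show ?thesis .
    qed
    then have "of_rat q * (y * b) + y * w \<in> V"
      using step unfolding V_def by (intro Q.span_add Q.span_scale)
    then show ?case by (simp add: algebra_simps)
  qed
  define z where "z = x + of_nat c * y"
  have zV: "z * w \<in> V" if "w \<in> V" for w
  proof -
    have "x * w + of_rat (of_nat c) * (y * w) \<in> V"
      using xV[OF that] yV[OF that] unfolding V_def by (intro Q.span_add Q.span_scale)
    then show ?thesis by (simp add: z_def algebra_simps)
  qed
  have mn: "m > 0" "n > 0" using u v by (auto intro!: Nat.gr0I)
  have pow: "z ^ i \<in> V" for i
    using B[of 0 0] mn by (induction i) (auto intro: zV)
  define N where "N = card B"
  have finB: "finite B" by (simp add: B_def)
  show ?thesis
  proof (cases "inj_on (\<lambda>i. z ^ i) {..N}")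
    case False
    then obtain i j where ij: "i \<noteq> j" "z ^ i = z ^ j" by (auto simp: inj_on_def)
    define p where "p = monom (1 :: 'a) i - monom 1 j"
    have "coeff p i = 1" using ij by (simp add: p_def)
    then have "p \<noteq> 0" by auto
    moreover have "poly p z = 0" using ij by (simp add: p_def poly_monom)
    moreover have "p \<in> polys_over \<rat>"
      unfolding p_def by (intro R.polys_over_diff R.polys_over_monom) auto
    ultimately show ?thesis unfolding algebraic_over_def z_def by blast
  next
    case True
    define P where "P = (\<lambda>i. z ^ i) ` {..N}"
    have "card P = Suc N" using True by (simp add: P_def card_image)
    then have "Q.dependent P"
      using Q.independent_span_bound[OF finB, of P] pow by (force simp: P_def N_def V_def)
    moreover have "finite P" by (simp add: P_def)
    ultimately obtain w where w: "\<exists>v\<in>P. w v \<noteq> 0" "(\<Sum>v\<in>P. of_rat (w v) * v) = 0"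
      by (auto simp: Q.dependent_finite)
    define p where "p = (\<Sum>i\<le>N. monom (of_rat (w (z ^ i)) :: 'a) i)"
    have cf: "coeff p i = (if i \<le> N then of_rat (w (z ^ i)) else 0)" for i
      by (simp add: p_def coeff_sum if_distrib cong: if_cong)
    obtain i where "i \<le> N" "w (z ^ i) \<noteq> 0" using w(1) by (auto simp: P_def)
    then have "coeff p i \<noteq> 0" by (simp add: cf)
    then have "p \<noteq> 0" by auto
    moreover have "p \<in> polys_over \<rat>" by (simp add: polys_over_def cf)
    moreover have "poly p z = (\<Sum>v\<in>P. of_rat (w v) * v)"
      unfolding P_def by (subst sum.reindex[OF True]) (simp add: p_def poly_sum poly_monom)
    ultimately show ?thesis using w(2) unfolding algebraic_over_def z_def by metis
  qed
qed


text \<open>Take \<open>z = x + c y\<close>, where \<open>c\<close> avoids the finitely many quotients \<open>(a - x) /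
(y - b)\<close> for conjugates \<open>a\<close> of \<open>x\<close> and \<open>b\<close> of
\<open>y\<close>. Then \<open>y\<close> is the only common root of its minimal polynomial \<open>m\<close>
and of \<open>f(z - c X)\<close>, where \<open>f(x) = 0\<close>, and it is a simple root of
\<open>m\<close>. The minimal polynomial of \<open>y\<close> over \<open>\<rat>(z)\<close> divides both, so
it is linear.\<close>

lemma primitive_element:
  fixes x y :: complex
  assumes x: "algebraic_over \<rat> x" and y: "algebraic_over \<rat> y"
  obtains z where "algebraic_over \<rat> z" "x \<in> adjoin \<rat> z" "y \<in> adjoin \<rat> z"
proof -
  interpret R: subfield_of "\<rat> :: complex set" by (rule subfield_of_Rats)
  obtain f where f: "f \<in> polys_over \<rat>" "f \<noteq> 0" "poly f x = 0"
    using x by (auto simp: algebraic_over_def)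
  obtain m where m: "m \<in> polys_over \<rat>" "m \<noteq> 0" "poly m y = 0" "degree m > 0"
    and mdvd: "\<And>p. p \<in> polys_over \<rat> \<Longrightarrow> poly p y = 0 \<Longrightarrow> \<exists>q\<in>polys_over \<rat>. p = m * q"
    using R.minimal_polynomial[OF y] by metis
  have simple: "poly (pderiv m) y \<noteq> 0"
  proof
    assume "poly (pderiv m) y = 0"
    then obtain q where q: "pderiv m = m * q" using mdvd R.polys_over_pderiv m(1) by blast
    moreover have "pderiv m \<noteq> 0" using m(4) by (simp add: pderiv_eq_0_iff)
    ultimately have "degree m \<le> degree (pderiv m)" by (simp add: degree_mult_eq)
    then show False using m(4) by (simp add: degree_pderiv)
  qed
  \<comment> \<open>the values of c for which z fails to separate a pair of conjugates\<close>
  define bad where "bad = (\<lambda>(a, b). (a - x) / (y - b)) ` ({a. poly f a = 0} \<times> {b. poly m b = 0})"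
  have "finite bad" using f m by (simp add: bad_def poly_roots_finite)
  then have "\<not> range (of_nat :: nat \<Rightarrow> complex) \<subseteq> bad"
    using finite_subset infinite_UNIV_nat inj_of_nat finite_imageD by blast
  then obtain c :: nat where c: "of_nat c \<notin> bad" by blast
  define z where "z = x + of_nat c * y"
  have z: "algebraic_over \<rat> z" unfolding z_def by (rule algebraic_over_Rats_add_mult[OF x y])
  interpret L: subfield_of "adjoin \<rat> z" by (rule R.subfield_of_adjoin[OF z])
  note RL = polys_over_mono[OF R.subset_adjoin[of z]]
  define F where "F = pcompose f [:z, - of_nat c:]"
  have FL: "F \<in> polys_over (adjoin \<rat> z)"
    unfolding F_def using f(1) RL R.mem_adjoin[of z]
    by (intro L.polys_over_pcompose L.polys_over_pCons L.polys_over_0 L.uminus_mem L.of_nat_mem) auto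
  have Fy: "poly F y = 0" using f(3) by (simp add: F_def poly_pcompose z_def algebra_simps)
  have yL: "algebraic_over (adjoin \<rat> z) y"
    unfolding algebraic_over_def using m RL by (intro bexI[of _ m]) auto
  obtain d where d: "d \<in> polys_over (adjoin \<rat> z)" "d \<noteq> 0" "poly d y = 0"
    and ddvd: "\<And>p. p \<in> polys_over (adjoin \<rat> z) \<Longrightarrow> poly p y = 0 \<Longrightarrow>
                 \<exists>q\<in>polys_over (adjoin \<rat> z). p = d * q"
    using L.minimal_polynomial[OF yL] by metis
  obtain q1 where q1: "m = d * q1" using ddvd[of m] m RL by auto
  obtain q2 where q2: "F = d * q2" using ddvd[OF FL Fy] by auto
  have only: "b = y" if b: "poly d b = 0" for b
  proof (rule ccontr)
    assume "b \<noteq> y"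
    have "poly m b = 0" "poly F b = 0" using b q1 q2 by simp_all
    then have "poly m b = 0" "poly f (z - of_nat c * b) = 0"
      by (simp_all add: F_def poly_pcompose mult.commute)
    then have "((z - of_nat c * b) - x) / (y - b) \<in> bad" unfolding bad_def by force
    moreover have "((z - of_nat c * b) - x) / (y - b) = of_nat c"
      using \<open>b \<noteq> y\<close> by (simp add: z_def field_simps)
    ultimately show False using c by simp
  qed
  obtain e where e: "d = [:- y, 1:] * e" using d(3) by (metis dvdE poly_eq_0_iff_dvd)
  have "degree e = 0"
  proof (rule ccontr)
    assume "degree e \<noteq> 0"
    then have "\<not> constant (poly e)" by (simp add: constant_degree)
    then obtain b where b: "poly e b = 0" using fundamental_theorem_of_algebra by blast
    then have "b = y" using only[of b] e by simp
    define w where "w = e * q1"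
    have "pderiv m = [:- y, 1:] * pderiv w + w * pderiv [:- y, 1:]"
      unfolding q1 e w_def mult.assoc[of _ e q1] by (rule pderiv_mult)
    moreover have "poly w y = 0" using b \<open>b = y\<close> by (simp add: w_def)
    ultimately have "poly (pderiv m) y = 0" by simp
    then show False using simple by simp
  qed
  then obtain k where k: "e = [:k:]" by (elim degree_eq_zeroE)
  have dk: "d = [:- y * k, k:]" using e k by simp
  have "k \<noteq> 0" using d(2) dk by auto
  have "- y * k \<in> adjoin \<rat> z" "k \<in> adjoin \<rat> z"
    using d(1) unfolding dk by (auto simp: L.polys_over_pCons_iff)
  then have "- ((- y * k) / k) \<in> adjoin \<rat> z" by (intro L.uminus_mem L.divide_mem)
  then have yL: "y \<in> adjoin \<rat> z" using \<open>k \<noteq> 0\<close> by simp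
  have "z - of_nat c * y \<in> adjoin \<rat> z"
    using yL R.mem_adjoin by (intro L.diff_mem L.mult_mem L.of_nat_mem)
  then have "x \<in> adjoin \<rat> z" by (simp add: z_def)
  then show thesis using that z yL by blast
qed

lemma polys_over_Rats_of_int: "map_poly of_int p \<in> polys_over (\<rat> :: complex set)"
  by (simp add: polys_over_def coeff_map_poly)

lemma common_root_field:
  assumes "finite S" "\<And>f. f \<in> S \<Longrightarrow> degree (f :: int poly) > 0"
  shows "\<exists>z :: complex. algebraic_over \<rat> z \<and>
           (\<forall>f\<in>S. \<exists>x\<in>adjoin \<rat> z. poly (map_poly of_int f) x = 0)"
  using assms
proof (induction S rule: finite_induct)
  case empty
  have "algebraic_over \<rat> (0 :: complex)"
    unfolding algebraic_over_def
    by (intro bexI[of _ "[:0, 1:]"])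
       (auto simp: polys_over_def coeff_pCons split: nat.splits)
  then show ?case by auto
next
  case (insert f S)
  then obtain z1 :: complex where z1: "algebraic_over \<rat> z1"
    and S: "\<forall>f\<in>S. \<exists>x\<in>adjoin \<rat> z1. poly (map_poly of_int f) x = 0" by auto
  have deg: "degree (map_poly of_int f :: complex poly) > 0"
    using insert.prems[of f] by (simp add: degree_map_poly)
  then have "\<not> constant (poly (map_poly of_int f :: complex poly))" by (simp add: constant_degree)
  then obtain x where x: "poly (map_poly of_int f) x = (0 :: complex)"
    using fundamental_theorem_of_algebra by blast
  moreover have "(map_poly of_int f :: complex poly) \<noteq> 0" using deg by auto
  ultimately have "algebraic_over \<rat> x"
    using polys_over_Rats_of_int by (auto simp: algebraic_over_def)
  then obtain z where z: "algebraic_over \<rat> z" "z1 \<in> adjoin \<rat> z" "x \<in> adjoin \<rat> z"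
    using primitive_element[OF z1] by blast
  have "adjoin \<rat> z1 \<subseteq> adjoin \<rat> z"
    using z(1,2) subfield_of.subfield_of_adjoin[OF subfield_of_Rats]
      subfield_of.subset_adjoin[OF subfield_of_Rats]
    by (intro adjoin_subset) auto
  then show ?case using z S x by blast
qed

lemma clear_denominators:
  assumes "p \<in> polys_over (\<rat> :: complex set)"
  obtains N P where "N > 0" "map_poly of_int P = smult (of_int N) p"
proof -
  interpret R: subfield_of "\<rat> :: complex set" by (rule subfield_of_Rats)
  have "\<exists>N>0. \<exists>P. map_poly of_int P = smult (of_int N) p"
    using assms
  proof (induction p)
    case 0
    show ?case by (intro exI[of _ 1] conjI exI[of _ 0]) auto
  next
    case (pCons c p)
    then have "c \<in> \<rat>" "p \<in> polys_over \<rat>" by (auto simp: R.polys_over_pCons_iff)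
    then obtain N P where N: "N > 0" "map_poly of_int P = smult (of_int N) p" using pCons by blast
    obtain a b where ab: "b > 0" "c = of_int a / of_int b"
      using \<open>c \<in> \<rat>\<close> by (auto elim!: Rats_cases')
    have "map_poly of_int (pCons (N * a) (smult b P)) = smult (of_int (N * b)) (pCons c p)"
      using N(2) ab by (simp add: map_poly_pCons map_poly_smult mult.commute)
    moreover have "N * b > 0" using N ab by simp
    ultimately show ?case by blast
  qed
  then show thesis using that by blast
qed

lemma poly_map_of_int: "poly (map_poly of_int p) (of_int x) = (of_int (poly p x) :: 'a :: comm_ring_1)"
  by (induction p) (auto simp: map_poly_pCons)

lemma dvd_poly_diff: "(x - y) dvd (poly p x - poly p (y :: 'a :: comm_ring_1))"
proof (induction p)
  case (pCons a p)
  have "poly (pCons a p) x - poly (pCons a p) y = (x - y) * poly p x + y * (poly p x - poly p y)"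
    by (simp add: algebra_simps)
  then show ?case using pCons by simp
qed auto

text \<open>Schur's argument: if \<open>c = g(0) \<noteq> 0\<close>, then \<open>g(c N x) = c (1 + N w)\<close> for some
\<open>w\<close>, and the second factor is prime to \<open>N\<close> and different from \<open>1\<close> and
\<open>-1\<close> for all but finitely many \<open>x\<close>. If \<open>c = 0\<close>, one takes \<open>t =
0\<close>.\<close>

lemma prime_divisor_of_value:
  fixes g :: "int poly"
  assumes "degree g > 0" "N \<noteq> 0"
  obtains p t where "prime (p :: nat)" "\<not> int p dvd N" "int p dvd poly g t"
proof (cases "coeff g 0 = 0")
  case True
  obtain p where p: "prime p" "p > nat \<bar>N\<bar>" using bigger_prime by blast
  have "\<not> int p dvd N" using p(2) assms(2) by (auto dest!: dvd_imp_le_int)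
  moreover have "poly g 0 = 0" using True by (simp add: poly_0_coeff_0)
  ultimately show thesis using that[of p 0] p by simp
next
  case False
  define c where "c = coeff g 0"
  have gc: "poly g 0 = c" by (simp add: c_def poly_0_coeff_0)
  define A where "A = {x. poly (g - [:c:]) x = 0} \<union> {x. poly (g - [:- c:]) x = 0}"
  have ne: "g - [:k:] \<noteq> 0" for k
    using assms(1) by (metis degree_pCons_0 eq_iff_diff_eq_0 less_irrefl)
  have "finite A" unfolding A_def by (intro finite_UnI poly_roots_finite ne)
  have cN: "c * N \<noteq> 0" using False assms c_def by simp
  then have "inj (\<lambda>x. c * N * x)" by (intro injI) simp
  then have "infinite (range (\<lambda>x. c * N * x))" using finite_imageD infinite_UNIV_int by blast
  then have "\<not> range (\<lambda>x. c * N * x) \<subseteq> A"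
    using \<open>finite A\<close> finite_subset by metis
  then obtain x where x: "c * N * x \<notin> A" by blast
  obtain w where w: "poly g (c * N * x) - poly g 0 = (c * N * x - 0) * w"
    using dvd_poly_diff[of "c * N * x" 0 g] by (elim dvdE)
  define u where "u = 1 + N * (x * w)"
  have gu: "poly g (c * N * x) = c * u" using w gc by (simp add: u_def algebra_simps)
  have "nat \<bar>u\<bar> \<noteq> 1"
  proof
    assume "nat \<bar>u\<bar> = 1"
    then have "u = 1 \<or> u = - 1" by linarith
    then show False using gu x by (auto simp: A_def)
  qed
  then obtain p where p: "prime p" "p dvd nat \<bar>u\<bar>" using prime_factor_nat by blast
  then have pu: "int p dvd u" by simp
  have "\<not> int p dvd N"
  proof
    assume "int p dvd N"
    then have "int p dvd N * (x * w)" by simp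
    with pu have "int p dvd u - N * (x * w)" by (rule dvd_diff)
    then have "int p dvd 1" by (simp add: u_def)
    then show False using p(1) by (auto dest: prime_gt_1_nat)
  qed
  then show thesis using that[of p "c * N * x"] p pu gu by simp
qed

text \<open>The right-hand side is \<open>f(h / e)\<close> with denominators cleared, while \<open>x\<close> plays the
role of \<open>h / e\<close> modulo \<open>p\<close>.\<close>

lemma poly_homogenize_cong:
  fixes f :: "int poly"
  assumes "[e * x = h] (mod p)"
  shows "[e ^ degree f * poly f x = (\<Sum>i\<le>degree f. coeff f i * h ^ i * e ^ (degree f - i))] (mod p)"
proof -
  have "e ^ degree f * poly f x = (\<Sum>i\<le>degree f. coeff f i * (e * x) ^ i * e ^ (degree f - i))"
    unfolding poly_altdef sum_distrib_left
  proof (intro sum.cong refl)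
    fix i assume "i \<in> {..degree f}"
    then have "e ^ degree f = e ^ i * e ^ (degree f - i)" by (simp flip: power_add)
    then show "e ^ degree f * (coeff f i * x ^ i) = coeff f i * (e * x) ^ i * e ^ (degree f - i)"
      by (simp add: power_mult_distrib mult_ac)
  qed
  also have "[\<dots> = (\<Sum>i\<le>degree f. coeff f i * h ^ i * e ^ (degree f - i))] (mod p)"
    by (intro cong_sum cong_mult cong_pow assms cong_refl)
  finally show ?thesis .
qed

text \<open>Let the number field \<open>\<rat>(z)\<close> contain a root \<open>h\<^sub>f(z)\<close> of each
\<open>f\<close>, and let \<open>m\<close> be the minimal polynomial of \<open>z\<close>. Then
\<open>m\<close> divides \<open>f \<circ> h\<^sub>f\<close>. If \<open>p\<close> divides the value of
\<open>m\<close> at an integer \<open>t\<close> and \<open>p\<close> divides none of the denominators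
involved, then \<open>h\<^sub>f(t)\<close> is a root of \<open>f\<close> modulo \<open>p\<close>. Such
\<open>p\<close> are supplied by Schur's argument.\<close>

lemma common_prime_with_roots:
  assumes S: "finite S" "\<And>f. f \<in> S \<Longrightarrow> degree (f :: int poly) > 0" and N: "N \<noteq> 0"
  obtains p where "prime (p :: nat)" "\<not> int p dvd N" "\<And>f. f \<in> S \<Longrightarrow> \<exists>x. int p dvd poly f x"
proof -
  interpret R: subfield_of "\<rat> :: complex set" by (rule subfield_of_Rats)
  obtain z :: complex where z: "algebraic_over \<rat> z"
    and root: "\<And>f. f \<in> S \<Longrightarrow> \<exists>x\<in>adjoin \<rat> z. poly (map_poly of_int f) x = 0"
    using common_root_field[OF S] by blast
  obtain m where m: "m \<in> polys_over \<rat>" "m \<noteq> 0" "poly m z = 0" "degree m > 0"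
    and mdvd: "\<And>p. p \<in> polys_over \<rat> \<Longrightarrow> poly p z = 0 \<Longrightarrow> \<exists>q\<in>polys_over \<rat>. p = m * q"
    using R.minimal_polynomial[OF z] by metis
  obtain M G where M: "M > 0" "map_poly of_int G = smult (of_int M) m"
    using clear_denominators[OF m(1)] .
  have "degree G = degree (map_poly of_int G :: complex poly)" by (simp add: degree_map_poly)
  then have degG: "degree G > 0" using M m by simp
  have "\<exists>E. E \<noteq> 0 \<and> (\<forall>p t. prime (p::nat) \<longrightarrow> \<not> int p dvd E \<longrightarrow> int p dvd poly G t \<longrightarrow>
          (\<exists>x. int p dvd poly f x))" if f: "f \<in> S" for f
  proof -
    obtain h where h: "h \<in> polys_over \<rat>" "poly (map_poly of_int f) (poly h z) = 0"
      using root[OF f] by (auto simp: adjoin_def)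
    define F where "F = pcompose (map_poly of_int f) h"
    have "F \<in> polys_over \<rat>" unfolding F_def
      by (intro R.polys_over_pcompose h polys_over_Rats_of_int)
    moreover have "poly F z = 0" using h by (simp add: F_def poly_pcompose)
    ultimately obtain k where k: "k \<in> polys_over \<rat>" "F = m * k" using mdvd by blast
    obtain e H where e: "e > 0" "map_poly of_int H = smult (of_int e) h"
      using clear_denominators[OF h(1)] .
    obtain K L where K: "K > 0" "map_poly of_int L = smult (of_int K) k"
      using clear_denominators[OF k(1)] .
    have "\<exists>x. int p dvd poly f x"
      if p: "prime p" "\<not> int p dvd e * (M * K)" "int p dvd poly G t" for p :: nat and t
    proof -
      have pe: "\<not> int p dvd e" "\<not> int p dvd M * K" using p(2) by auto
      then have "coprime e (int p)" using p(1) prime_imp_coprime[of "int p" e] by (simp add: coprime_commute)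
      then obtain e' where e': "[e * e' = 1] (mod int p)" using cong_solve_coprime_int by blast
      define x where "x = e' * poly H t"
      have ex: "[e * x = poly H t] (mod int p)"
        using cong_scalar_right[OF e', of "poly H t"] by (simp add: x_def mult.assoc)
      define n where "n = degree f"
      define s where "s = (\<Sum>i\<le>n. coeff f i * poly H t ^ i * e ^ (n - i))"
      have cong: "[e ^ n * poly f x = s] (mod int p)"
        unfolding s_def n_def by (rule poly_homogenize_cong[OF ex])
      define hz where "hz = poly h (of_int t)"
      have Ht: "of_int (poly H t) = (of_int e * hz :: complex)"
        unfolding hz_def using arg_cong[OF e(2), of "\<lambda>q. poly q (of_int t)"]
        by (simp add: poly_map_of_int)
      have "of_int s = (\<Sum>i\<le>n. of_int (coeff f i) * (of_int e * hz) ^ i * (of_int e ^ (n - i) :: complex))"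
        by (simp add: s_def Ht)
      also have "\<dots> = of_int e ^ n * (\<Sum>i\<le>n. of_int (coeff f i) * hz ^ i)"
        unfolding sum_distrib_left
      proof (intro sum.cong refl)
        fix i assume "i \<in> {..n}"
        then have "(of_int e :: complex) ^ n = of_int e ^ i * of_int e ^ (n - i)"
          by (simp flip: power_add)
        then show "of_int (coeff f i) * (of_int e * hz) ^ i * of_int e ^ (n - i)
            = of_int e ^ n * (of_int (coeff f i) * hz ^ i)"
          by (simp add: power_mult_distrib mult_ac)
      qed
      also have "(\<Sum>i\<le>n. of_int (coeff f i) * hz ^ i) = poly F (of_int t)"
        unfolding F_def poly_pcompose hz_def[symmetric] poly_altdef[of "map_poly of_int f"]
        by (simp add: n_def degree_map_poly coeff_map_poly)
      finally have sF: "of_int s = of_int e ^ n * poly F (of_int t)" .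
      have "of_int (M * K * s) = (of_int (e ^ n * (poly G t * poly L t)) :: complex)"
        using arg_cong[OF M(2), of "\<lambda>q. poly q (of_int t)"]
          arg_cong[OF K(2), of "\<lambda>q. poly q (of_int t)"]
        by (simp add: sF k(2) poly_map_of_int)
      then have "M * K * s = e ^ n * (poly G t * poly L t)" by (simp only: of_int_eq_iff)
      then have "int p dvd M * K * s" using p(3) by simp
      then have "int p dvd s" using pe(2) p(1) by (simp add: prime_dvd_mult_iff)
      then have "int p dvd e ^ n * poly f x" using cong cong_dvd_iff by blast
      then have "int p dvd poly f x"
        using pe(1) p(1) by (auto simp: prime_dvd_mult_iff dest: prime_dvd_power[rotated])
      then show ?thesis by blast
    qed
    moreover have "e * (M * K) \<noteq> 0" using e M K by simp
    ultimately show ?thesis by blast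
  qed
  then obtain E where E: "\<And>f. f \<in> S \<Longrightarrow> E f \<noteq> 0"
    "\<And>f p t. f \<in> S \<Longrightarrow> prime (p::nat) \<Longrightarrow> \<not> int p dvd E f \<Longrightarrow> int p dvd poly G t \<Longrightarrow>
          \<exists>x. int p dvd poly f x"
    by metis
  have "N * (\<Prod>f\<in>S. E f) \<noteq> 0" using N E(1) S(1) by simp
  then obtain p t where p: "prime p" "\<not> int p dvd N * (\<Prod>f\<in>S. E f)" "int p dvd poly G t"
    using prime_divisor_of_value[OF degG] by blast
  have "\<exists>x. int p dvd poly f x" if f: "f \<in> S" for f
  proof (rule E(2)[OF f p(1) _ p(3)])
    have "E f dvd (\<Prod>f\<in>S. E f)" using f S(1) by (rule dvd_prodI[rotated])
    then show "\<not> int p dvd E f" using p(2) dvd_trans dvd_mult by blast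
  qed
  moreover have "\<not> int p dvd N" using p(2) dvd_mult2 by blast
  ultimately show thesis using p(1) that[of p] by blast
qed

section \<open>Equivalence of binary cubic forms\<close>

definition mat2 :: "int \<Rightarrow> int \<Rightarrow> int \<Rightarrow> int \<Rightarrow> int^2^2" where
  "mat2 p q r s = vector [vector [p, q], vector [r, s]]"

lemma mat2_nth [simp]:
  "mat2 p q r s $ 1 $ 1 = p" "mat2 p q r s $ 1 $ 2 = q"
  "mat2 p q r s $ 2 $ 1 = r" "mat2 p q r s $ 2 $ 2 = s"
  by (simp_all add: mat2_def)

lemma mat2_eta: "g = mat2 (g$1$1) (g$1$2) (g$2$1) (g$2$2)"
  by (simp add: vec_eq_iff forall_2)

lemma mat2_eq_iff: "mat2 p q r s = mat2 p' q' r' s' \<longleftrightarrow> p = p' \<and> q = q' \<and> r = r' \<and> s = s'"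
  by (metis mat2_nth)

lemma det_mat2 [simp]: "det (mat2 p q r s) = p * s - q * r"
  by (simp add: det_2)

lemma mat_1_eq_mat2: "mat 1 = mat2 1 0 0 1"
  by (simp add: vec_eq_iff forall_2 mat_def)

lemma cubic_act_mat2:
  assumes "p * s - q * r = 1"
  shows "cubic_act (mat2 p q r s) (Cubic a b c d) = Cubic
      (a * p^3 + b * p^2 * q + c * p * q^2 + d * q^3)
      (3 * a * p^2 * r + b * (p^2 * s + 2 * p * q * r) + c * (2 * p * q * s + q^2 * r) + 3 * d * q^2 * s)
      (3 * a * p * r^2 + b * (2 * p * r * s + q * r^2) + c * (p * s^2 + 2 * q * r * s) + 3 * d * q * s^2)
      (a * r^3 + b * r^2 * s + c * r * s^2 + d * s^3)"
  using assms by (simp add: Let_def)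

definition form_equiv :: "cubic \<Rightarrow> cubic \<Rightarrow> bool" where
  "form_equiv f f' \<longleftrightarrow> (\<exists>g. det g = 1 \<and> cubic_act g f = f')"

lemma form_equiv_refl: "form_equiv f f"
  unfolding form_equiv_def by (rule exI[of _ "mat 1"]) (simp add: cubic_act_one)

lemma form_equiv_trans: "form_equiv f f' \<Longrightarrow> form_equiv f' f'' \<Longrightarrow> form_equiv f f''"
  unfolding form_equiv_def by (metis cubic_act_mult det_mul mult_1)

lemma SL2Z_inverse:
  assumes "det (g :: int^2^2) = 1"
  obtains h where "det h = 1" "h ** g = mat 1" "g ** h = mat 1"
proof -
  interpret group SL2Z by (rule group_SL2Z)
  have "g \<in> carrier SL2Z" using assms by (simp add: SL2Z_def)
  then show thesis
    using that[of "inv\<^bsub>SL2Z\<^esub> g"] l_inv[of g] r_inv[of g] inv_closed[of g]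
    by (simp add: SL2Z_def)
qed

lemma cubic_act_cancel:
  assumes "h ** g = mat 1"
  shows "cubic_act h (cubic_act g f) = f"
  by (simp add: assms cubic_act_one flip: cubic_act_mult)

lemma form_equiv_sym: "form_equiv f f' \<Longrightarrow> form_equiv f' f"
  unfolding form_equiv_def by (metis SL2Z_inverse cubic_act_cancel)

lemma form_equiv_disc: "form_equiv f f' \<Longrightarrow> cubic_disc f' = cubic_disc f"
  unfolding form_equiv_def by (auto simp: cubic_disc_act)

lemma form_equiv_mat2:
  "p * s - q * r = 1 \<Longrightarrow> form_equiv f (cubic_act (mat2 p q r s) f)"
  unfolding form_equiv_def by (metis det_mat2)

definition form_orbit :: "cubic \<Rightarrow> cubic set" where
  "form_orbit f = orbit SL2Z cubic_act f"

lemma form_orbit_eq: "form_orbit f = Collect (form_equiv f)"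
  by (auto simp: form_orbit_def orbit_def form_equiv_def SL2Z_def)

lemma form_orbit_eq_iff: "form_orbit f = form_orbit f' \<longleftrightarrow> form_equiv f f'"
  unfolding form_orbit_eq using form_equiv_refl form_equiv_sym form_equiv_trans
  by (metis (no_types, lifting) Collect_cong mem_Collect_eq)

definition stab_card :: "cubic \<Rightarrow> nat" where
  "stab_card f = card (stabilizer SL2Z cubic_act f)"

lemma mem_stabilizer: "g \<in> stabilizer SL2Z cubic_act f \<longleftrightarrow> det g = 1 \<and> cubic_act g f = f"
  by (auto simp: stabilizer_def SL2Z_def)

lemma stab_card_equiv: "form_equiv f f' \<Longrightarrow> stab_card f' = stab_card f"
  unfolding form_equiv_def stab_card_def using card_stabilizer_act by (auto simp: SL2Z_def)

definition disc_orbits :: "int \<Rightarrow> cubic set set" where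
  "disc_orbits D = form_orbit ` {f. cubic_disc f = D}"

definition orbit_weight :: "cubic set \<Rightarrow> real" where
  "orbit_weight X = 1 / real (card (stabilizer SL2Z cubic_act (SOME f. f \<in> X)))"

lemma orbit_weight: "orbit_weight (form_orbit f) = 1 / real (stab_card f)"
proof -
  have "(SOME f'. f' \<in> form_orbit f) \<in> form_orbit f"
    by (rule someI[of _ f]) (simp add: form_orbit_eq form_equiv_refl)
  then have "form_equiv f (SOME f'. f' \<in> form_orbit f)" by (simp add: form_orbit_eq)
  from stab_card_equiv[OF this] show ?thesis by (simp add: orbit_weight_def stab_card_def)
qed

text \<open>The sign and the index enter only through the discriminant \<open>\<epsilon> n\<close>, in terms of which
the rest of the argument is phrased.\<close>

lemma shintani_coeff_eq: "shintani_coeff \<epsilon> n = sum orbit_weight (disc_orbits (\<epsilon> * int n))"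
proof -
  have "{X \<in> orbits SL2Z UNIV cubic_act. \<forall>f\<in>X. cubic_disc f = \<epsilon> * int n} = disc_orbits (\<epsilon> * int n)"
    using form_equiv_disc form_equiv_refl
    by (auto simp: disc_orbits_def orbits_def image_iff form_orbit_eq simp flip: form_orbit_def)
  then show ?thesis by (simp add: shintani_coeff_def orbit_weight_def)
qed

section \<open>Roots modulo p and subrings of index p\<close>

text \<open>The forms with root \<open>(1 : 0)\<close> modulo \<open>p\<close> are \<open>rooted_form p t\<close>, and
\<open>subring_form p t\<close> is \<open>f(u, p v) / p\<close> for \<open>f = rooted_form p t\<close>: the
form of the subring of index \<open>p\<close> that belongs to this root. The common parameter
\<open>t\<close> avoids the division by \<open>p\<close>.\<close>

fun rooted_form :: "int \<Rightarrow> cubic \<Rightarrow> cubic" where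
  "rooted_form p (Cubic a b c d) = Cubic (p * a) b c d"

fun subring_form :: "int \<Rightarrow> cubic \<Rightarrow> cubic" where
  "subring_form p (Cubic a b c d) = Cubic a b (p * c) (p^2 * d)"

lemma disc_subring_form: "cubic_disc (subring_form p t) = p^2 * cubic_disc (rooted_form p t)"
  by (cases t) (simp add: algebra_simps power2_eq_square power3_eq_cube)

lemma rooted_form_eq_iff: "p \<noteq> 0 \<Longrightarrow> rooted_form p t = rooted_form p t' \<longleftrightarrow> t = t'"
  by (cases t; cases t') auto

lemma subring_form_eq_iff: "p \<noteq> 0 \<Longrightarrow> subring_form p t = subring_form p t' \<longleftrightarrow> t = t'"
  by (cases t; cases t') auto

text \<open>The substitution \<open>v \<mapsto> p v\<close> conjugates the group of matrices with upper right entry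
divisible by \<open>p\<close> into the group of matrices with lower left entry divisible by
\<open>p\<close>.\<close>

lemma act_rooted_subring_form:
  assumes "P * S - p * Q * R = 1"
  shows "\<exists>t'. cubic_act (mat2 P (p * Q) R S) (rooted_form p t) = rooted_form p t' \<and>
              cubic_act (mat2 P Q (p * R) S) (subring_form p t) = subring_form p t'"
proof -
  obtain a b c d where t: "t = Cubic a b c d" by (cases t)
  have d: "P * S - (p * Q) * R = 1" "P * S - Q * (p * R) = 1" using assms by (simp_all add: mult_ac)
  show ?thesis
    unfolding t rooted_form.simps subring_form.simps cubic_act_mat2[OF d(1)] cubic_act_mat2[OF d(2)]
    by (rule exI[of _ "Cubic (a * P^3 + b * P^2 * Q + p * c * P * Q^2 + p^2 * d * Q^3)
      (3 * (p * a) * P^2 * R + b * (P^2 * S + 2 * P * (p * Q) * R)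
        + c * (2 * P * (p * Q) * S + (p * Q)^2 * R) + 3 * d * (p * Q)^2 * S)
      (3 * (p * a) * P * R^2 + b * (2 * P * R * S + (p * Q) * R^2)
        + c * (P * S^2 + 2 * (p * Q) * R * S) + 3 * d * (p * Q) * S^2)
      ((p * a) * R^3 + b * R^2 * S + c * R * S^2 + d * S^3)"])
      (simp add: algebra_simps power2_eq_square power3_eq_cube)
qed

definition nonresidue :: "int \<Rightarrow> int \<Rightarrow> bool" where
  "nonresidue p D \<longleftrightarrow> (\<forall>x. \<not> p dvd x^2 - D)"

lemma nonresidue_not_dvd: "nonresidue p D \<Longrightarrow> \<not> p dvd D"
  unfolding nonresidue_def by (drule spec[of _ 0]) simp

lemma mod_inverse:
  assumes "prime (p :: int)" "\<not> p dvd y"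
  obtains y' k where "y * y' = 1 + p * k"
proof -
  have "coprime y p" using assms prime_imp_coprime coprime_commute by blast
  then obtain y' where "[y * y' = 1] (mod p)" using cong_solve_coprime_int by blast
  then obtain k where "y * y' - 1 = p * k" by (auto simp: cong_iff_dvd_diff elim!: dvdE)
  then show thesis using that[of y' k] by (simp add: algebra_simps)
qed

lemma nonresidue_norm:
  assumes "prime p" "nonresidue p D" "p dvd x^2 - D * y^2"
  shows "p dvd y"
proof (rule ccontr)
  assume "\<not> p dvd y"
  then obtain y' k where k: "y * y' = 1 + p * k" using mod_inverse[OF assms(1)] by blast
  obtain m where m: "x^2 - D * y^2 = p * m" using assms(3) by (elim dvdE)
  have "(x * y')^2 - D = p * (m * y'^2 + D * (2 * k + p * k^2))" using k m by algebra
  then have "p dvd (x * y')^2 - D" by (metis dvd_triv_left)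
  then show False using assms(2) by (simp add: nonresidue_def)
qed

text \<open>If \<open>p\<close> does not divide \<open>Q\<close>, then \<open>(P : Q)\<close> is a second root modulo
\<open>p\<close>. A cubic form with two roots in the field with \<open>p\<close> elements has all three of
them there, so its discriminant is a square.\<close>

lemma root_unique:
  assumes p: "prime p" and nr: "nonresidue p (cubic_disc (rooted_form p t))"
    and det: "P * S - Q * R = 1"
    and eq: "cubic_act (mat2 P Q R S) (rooted_form p t) = rooted_form p t'"
  shows "p dvd Q"
proof (rule ccontr)
  assume nQ: "\<not> p dvd Q"
  obtain a b c d where t: "t = Cubic a b c d" by (cases t)
  obtain a' b' c' d' where t': "t' = Cubic a' b' c' d'" by (cases t')
  have "p * a * P^3 + b * P^2 * Q + c * P * Q^2 + d * Q^3 = p * a'"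
    using eq unfolding t t' rooted_form.simps cubic_act_mat2[OF det] by simp
  then have "Q * (b * P^2 + c * P * Q + d * Q^2) = p * (a' - a * P^3)" by algebra
  then have "p dvd b * P^2 + c * P * Q + d * Q^2"
    using nQ p by (metis dvd_triv_left prime_dvd_mult_iff)
  then obtain k where k: "b * P^2 + c * P * Q + d * Q^2 = p * k" by (elim dvdE)
  define D where "D = cubic_disc (rooted_form p t)"
  have D: "D = b^2 * c^2 - 4 * (p*a) * c^3 - 4 * b^3 * d - 27 * (p*a)^2 * d^2 + 18 * (p*a) * b * c * d"
    by (simp add: D_def t)
  have "(b * (2 * b * P + c * Q))^2 - D * Q^2
      = 4 * b^3 * (b * P^2 + c * P * Q + d * Q^2)
        + p * (Q^2 * (4 * a * c^3 + 27 * p * a^2 * d^2 - 18 * a * b * c * d))"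
    unfolding D by algebra
  also have "\<dots> = p * (4 * b^3 * k + Q^2 * (4 * a * c^3 + 27 * p * a^2 * d^2 - 18 * a * b * c * d))"
    unfolding k by algebra
  finally have "(b * (2 * b * P + c * Q))^2 - D * Q^2
    = p * (4 * b^3 * k + Q^2 * (4 * a * c^3 + 27 * p * a^2 * d^2 - 18 * a * b * c * d))" .
  then have "p dvd (b * (2 * b * P + c * Q))^2 - D * Q^2" by (metis dvd_triv_left)
  then show False using nonresidue_norm[OF p nr[folded D_def]] nQ by blast
qed

text \<open>Modulo \<open>p\<close> the form \<open>subring_form p t\<close> is \<open>u\<^sup>2\<close> times a linear
form, so \<open>(0 : 1)\<close> is a multiple root, and the equation says that \<open>(R : S)\<close> is
another one unless \<open>p\<close> divides \<open>R\<close>. A nonzero cubic form has at most one multiple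
root.\<close>

lemma double_root_unique:
  assumes p: "prime p" and D: "\<not> p dvd cubic_disc (rooted_form p t)"
    and det: "P * S - Q * R = 1"
    and eq: "cubic_act (mat2 P Q R S) (subring_form p t) = subring_form p t'"
  shows "p dvd R"
proof (rule ccontr)
  assume nR: "\<not> p dvd R"
  obtain a b c d where t: "t = Cubic a b c d" by (cases t)
  obtain a' b' c' d' where t': "t' = Cubic a' b' c' d'" by (cases t')
  have e3: "3 * a * P * R^2 + b * (2 * P * R * S + Q * R^2) + p * c * (P * S^2 + 2 * Q * R * S)
        + 3 * (p^2 * d) * Q * S^2 = p * c'"
    and e4: "a * R^3 + b * R^2 * S + p * c * R * S^2 + p^2 * d * S^3 = p^2 * d'"
    using eq unfolding t t' subring_form.simps cubic_act_mat2[OF det] by simp_all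
  have "R^2 * (a * R + b * S) = p * (p * d' - c * R * S^2 - p * d * S^3)" using e4 by algebra
  then have "p dvd a * R + b * S"
    using nR p by (metis dvd_triv_left prime_dvd_mult_iff power2_eq_square)
  then obtain k where k: "a * R + b * S = p * k" by (elim dvdE)
  define w where "w = c' - c * (P * S^2 + 2 * Q * R * S) - 3 * p * d * Q * S^2"
  have "3 * P * R * (a * R) + b * (2 * P * R * S + Q * R^2) = p * w"
    using e3 by (simp add: w_def algebra_simps power2_eq_square)
  moreover have "a * R = p * k - b * S" using k by simp
  ultimately have "3 * P * R * (p * k - b * S) + b * (2 * P * R * S + Q * R^2) = p * w" by simp
  then have "p * (3 * P * R * k - w) = b * R * (P * S - Q * R)" by (simp add: algebra_simps power2_eq_square)
  then have "p * (3 * P * R * k - w) = b * R" using det by simp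
  then have "p dvd b" using nR p by (metis dvd_triv_left prime_dvd_mult_iff)
  then obtain m where m: "b = p * m" by (elim dvdE)
  have "cubic_disc (rooted_form p t) = p * (p * m^2 * c^2 - 4 * a * c^3 - 4 * p^2 * m^3 * d - 27 * p * a^2 * d^2 + 18 * a * p * m * c * d)"
    by (simp add: t m algebra_simps power2_eq_square power3_eq_cube)
  then show False using D by simp
qed

text \<open>A subring of index \<open>p\<close> determines the ring that contains it, because the matrix must preserve
the multiple root modulo \<open>p\<close>. The explicit matrix is part of the conclusion since two roots of
the same form are distinguished by the matrices that relate them.\<close>

lemma rooted_equiv_if_subring_equiv:
  assumes p: "prime p" and D: "\<not> p dvd cubic_disc (rooted_form p t)"
    and eq: "form_equiv (subring_form p t) (subring_form p t')"
  shows "\<exists>P Q R S. P * S - p * Q * R = 1 \<and> cubic_act (mat2 P (p * Q) R S) (rooted_form p t) = rooted_form p t'"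
proof -
  obtain g where g: "det g = 1" "cubic_act g (subring_form p t) = subring_form p t'"
    using eq by (auto simp: form_equiv_def)
  obtain P Q R' S where gm: "g = mat2 P Q R' S" using mat2_eta by blast
  have det: "P * S - Q * R' = 1" using g(1) gm by simp
  have "p dvd R'" by (rule double_root_unique[OF p D det]) (use g gm in simp)
  then obtain R where R: "R' = p * R" by (elim dvdE)
  have det': "P * S - p * Q * R = 1" using det R by (simp add: mult_ac)
  obtain t'' where t'': "cubic_act (mat2 P (p * Q) R S) (rooted_form p t) = rooted_form p t''"
    "cubic_act (mat2 P Q (p * R) S) (subring_form p t) = subring_form p t''" using act_rooted_subring_form[OF det'] by blast
  then have "subring_form p t'' = subring_form p t'" using g gm R by simp
  then have "t'' = t'" using p subring_form_eq_iff[of p] by auto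
  then show ?thesis using det' t'' by blast
qed

lemma subring_equiv_if_rooted_equiv:
  assumes p: "prime p" and nr: "nonresidue p (cubic_disc (rooted_form p t))"
    and eq: "form_equiv (rooted_form p t) (rooted_form p t')"
  shows "form_equiv (subring_form p t) (subring_form p t')"
proof -
  obtain g where g: "det g = 1" "cubic_act g (rooted_form p t) = rooted_form p t'"
    using eq by (auto simp: form_equiv_def)
  obtain P Q' R S where gm: "g = mat2 P Q' R S" using mat2_eta by blast
  have det: "P * S - Q' * R = 1" using g(1) gm by simp
  have "p dvd Q'" by (rule root_unique[OF p nr det]) (use g gm in simp)
  then obtain Q where Q: "Q' = p * Q" by (elim dvdE)
  have det': "P * S - p * Q * R = 1" using det Q by (simp add: mult_ac)
  obtain t'' where t'': "cubic_act (mat2 P (p * Q) R S) (rooted_form p t) = rooted_form p t''"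
    "cubic_act (mat2 P Q (p * R) S) (subring_form p t) = subring_form p t''" using act_rooted_subring_form[OF det'] by blast
  then have "rooted_form p t'' = rooted_form p t'" using g gm Q by simp
  then have "t'' = t'" using p rooted_form_eq_iff[of p] by auto
  moreover have "P * S - Q * (p * R) = 1" using det' by (simp add: mult_ac)
  ultimately show ?thesis using t''(2) form_equiv_mat2[of P S Q "p * R" "subring_form p t"] by simp
qed

text \<open>The automorphisms of the subring are the automorphisms of the ring that fix the chosen root modulo
\<open>p\<close>.\<close>

lemma stab_card_subring_form:
  assumes p: "prime p" and D: "\<not> p dvd cubic_disc (rooted_form p t)"
  shows "stab_card (subring_form p t) = card {g \<in> stabilizer SL2Z cubic_act (rooted_form p t). p dvd g$1$2}"
  unfolding stab_card_def
proof (rule bij_betw_same_card)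
  have p0: "p \<noteq> 0" using p by auto
  have up: "p dvd g$2$1" if "g \<in> stabilizer SL2Z cubic_act (subring_form p t)" for g
    using that double_root_unique[OF p D, of "g$1$1" "g$2$2" "g$1$2" "g$2$1" t]
    by (simp add: mem_stabilizer det_2 flip: mat2_eta)
  show "bij_betw (\<lambda>g. mat2 (g$1$1) (p * g$1$2) (g$2$1 div p) (g$2$2))
      (stabilizer SL2Z cubic_act (subring_form p t))
      {g \<in> stabilizer SL2Z cubic_act (rooted_form p t). p dvd g$1$2}"
  proof (rule bij_betw_byWitness[where f' = "\<lambda>g. mat2 (g$1$1) (g$1$2 div p) (p * g$2$1) (g$2$2)"])
    show "\<forall>g\<in>stabilizer SL2Z cubic_act (subring_form p t).
        mat2 (mat2 (g$1$1) (p * g$1$2) (g$2$1 div p) (g$2$2)$1$1)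
          (mat2 (g$1$1) (p * g$1$2) (g$2$1 div p) (g$2$2)$1$2 div p)
          (p * mat2 (g$1$1) (p * g$1$2) (g$2$1 div p) (g$2$2)$2$1)
          (mat2 (g$1$1) (p * g$1$2) (g$2$1 div p) (g$2$2)$2$2) = g"
      using up p0 by (auto simp flip: mat2_eta)
    show "\<forall>g\<in>{g \<in> stabilizer SL2Z cubic_act (rooted_form p t). p dvd g$1$2}.
        mat2 (mat2 (g$1$1) (g$1$2 div p) (p * g$2$1) (g$2$2)$1$1)
          (p * mat2 (g$1$1) (g$1$2 div p) (p * g$2$1) (g$2$2)$1$2)
          (mat2 (g$1$1) (g$1$2 div p) (p * g$2$1) (g$2$2)$2$1 div p)
          (mat2 (g$1$1) (g$1$2 div p) (p * g$2$1) (g$2$2)$2$2) = g"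
      using p0 by (auto simp flip: mat2_eta)
    show "(\<lambda>g. mat2 (g$1$1) (p * g$1$2) (g$2$1 div p) (g$2$2)) ` stabilizer SL2Z cubic_act (subring_form p t)
        \<subseteq> {g \<in> stabilizer SL2Z cubic_act (rooted_form p t). p dvd g$1$2}"
    proof (rule image_subsetI)
      fix g assume g: "g \<in> stabilizer SL2Z cubic_act (subring_form p t)"
      obtain P Q R' S where gm: "g = mat2 P Q R' S" using mat2_eta by blast
      obtain R where R: "R' = p * R" using up[OF g] gm by (auto elim: dvdE)
      have det': "P * S - p * Q * R = 1" using g gm R by (simp add: mem_stabilizer mult_ac)
      obtain t'' where t'': "cubic_act (mat2 P (p * Q) R S) (rooted_form p t) = rooted_form p t''"
        "cubic_act (mat2 P Q (p * R) S) (subring_form p t) = subring_form p t''"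
        using act_rooted_subring_form[OF det'] by blast
      then have "t'' = t" using g gm R subring_form_eq_iff[OF p0] by (auto simp: mem_stabilizer)
      then show "mat2 (g$1$1) (p * g$1$2) (g$2$1 div p) (g$2$2)
          \<in> {g \<in> stabilizer SL2Z cubic_act (rooted_form p t). p dvd g$1$2}"
        using t'' det' p0 by (simp add: gm R mem_stabilizer)
    qed
    show "(\<lambda>g. mat2 (g$1$1) (g$1$2 div p) (p * g$2$1) (g$2$2)) `
        {g \<in> stabilizer SL2Z cubic_act (rooted_form p t). p dvd g$1$2} \<subseteq> stabilizer SL2Z cubic_act (subring_form p t)"
    proof (rule image_subsetI)
      fix g assume g: "g \<in> {g \<in> stabilizer SL2Z cubic_act (rooted_form p t). p dvd g$1$2}"
      obtain P Q' R S where gm: "g = mat2 P Q' R S" using mat2_eta by blast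
      obtain Q where Q: "Q' = p * Q" using g gm by (auto elim: dvdE)
      have det': "P * S - p * Q * R = 1" using g gm Q by (simp add: mem_stabilizer mult_ac)
      obtain t'' where t'': "cubic_act (mat2 P (p * Q) R S) (rooted_form p t) = rooted_form p t''"
        "cubic_act (mat2 P Q (p * R) S) (subring_form p t) = subring_form p t''"
        using act_rooted_subring_form[OF det'] by blast
      then have "t'' = t" using g gm Q rooted_form_eq_iff[OF p0] by (auto simp: mem_stabilizer)
      then show "mat2 (g$1$1) (g$1$2 div p) (p * g$2$1) (g$2$2) \<in> stabilizer SL2Z cubic_act (subring_form p t)"
        using t'' det' p0 by (simp add: gm Q mem_stabilizer mult_ac)
    qed
  qed
qed

lemma stab_card_subring_form_nonresidue:
  assumes p: "prime p" and nr: "nonresidue p (cubic_disc (rooted_form p t))"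
  shows "stab_card (subring_form p t) = stab_card (rooted_form p t)"
proof -
  have "p dvd g$1$2" if "g \<in> stabilizer SL2Z cubic_act (rooted_form p t)" for g
    using that root_unique[OF p nr, of "g$1$1" "g$2$2" "g$1$2" "g$2$1" t]
    by (simp add: mem_stabilizer det_2 flip: mat2_eta)
  then have "{g \<in> stabilizer SL2Z cubic_act (rooted_form p t). p dvd g$1$2} = stabilizer SL2Z cubic_act (rooted_form p t)"
    by blast
  then show ?thesis
    using stab_card_subring_form[OF p nonresidue_not_dvd[OF nr]] by (simp add: stab_card_def)
qed

section \<open>Existence of roots modulo p\<close>

definition has_root :: "int \<Rightarrow> cubic \<Rightarrow> bool" where
  "has_root p f \<longleftrightarrow> (\<exists>t. form_equiv f (rooted_form p t))"

lemma has_root_equiv: "form_equiv f f' \<Longrightarrow> has_root p f' \<Longrightarrow> has_root p f"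
  unfolding has_root_def using form_equiv_trans by blast

lemma has_root_infinity:
  assumes "p dvd a"
  shows "has_root p (Cubic a b c d)"
proof -
  obtain k where "a = p * k" using assms by (elim dvdE)
  then have "Cubic a b c d = rooted_form p (Cubic k b c d)" by simp
  then show ?thesis unfolding has_root_def using form_equiv_refl by metis
qed

lemma has_root_affine:
  assumes "p dvd a * k^3 + b * k^2 + c * k + d"
  shows "has_root p (Cubic a b c d)"
proof -
  have "has_root p (cubic_act (mat2 k 1 (-1) 0) (Cubic a b c d))"
    by (subst cubic_act_mat2) (use assms in \<open>auto intro!: has_root_infinity\<close>)
  then show ?thesis by (rule has_root_equiv[OF form_equiv_mat2, rotated]) simp
qed

text \<open>Let \<open>H\<close> be the Hessian and \<open>G\<close> the Jacobian covariant of \<open>f\<close> and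
\<open>H\<close>. Over a quadratic extension that splits \<open>H\<close> into conjugate linear forms,
\<open>f\<close> and \<open>G\<close> are combinations of their cubes, and factoring a difference of cubes
gives \<open>2 (G(P) f(P') - G(P') f(P)) = - T (S\<^sup>2 - D T\<^sup>2)\<close>, where \<open>T\<close> is
the determinant of \<open>P, P'\<close> and \<open>S\<close> is twice the polarised Hessian at \<open>P,
P'\<close>. If \<open>f\<close> had no root modulo \<open>p\<close>, then \<open>G / f\<close> would map the
\<open>p + 1\<close> points of the projective line to \<open>p\<close> residues, hence take equal values at
two distinct points. As \<open>S\<^sup>2 - D T\<^sup>2\<close> is anisotropic, this is impossible.\<close>

lemma nonresidue_has_root:
  assumes p: "prime p" and nr: "nonresidue p (cubic_disc f)"
  shows "has_root p f"
proof (rule ccontr)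
  assume no: "\<not> has_root p f"
  obtain a b c d where f: "f = Cubic a b c d" by (cases f)
  have p1: "p > 1" using p by (simp add: prime_gt_1_int)
  define F where "F = (\<lambda>x y. a * x^3 + b * x^2 * y + c * x * y^2 + d * y^3)"
  define h0 where "h0 = b^2 - 3 * a * c"
  define h1 where "h1 = b * c - 9 * a * d"
  define h2 where "h2 = c^2 - 3 * b * d"
  define G where "G = (\<lambda>x y. (3 * a * h1 - 2 * b * h0) * x^3 + (6 * a * h2 + b * h1 - 4 * c * h0) * x^2 * y
     + (4 * b * h2 - c * h1 - 6 * d * h0) * x * y^2 + (2 * c * h2 - 3 * d * h1) * y^3)"
  define D where "D = cubic_disc f"
  have key: "2 * (G x y * F x' y' - G x' y' * F x y) = (x' * y - x * y') *
      ((2 * h0 * x * x' + h1 * (x * y' + x' * y) + 2 * h2 * y * y')^2 - D * (x * y' - x' * y)^2)"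
    for x y x' y'
    unfolding G_def F_def h0_def h1_def h2_def D_def f cubic_disc.simps by algebra
  \<comment> \<open>the points of the projective line modulo p, with k = p standing for infinity\<close>
  define X where "X = (\<lambda>k. if k = p then 1 else k)"
  define Y where "Y = (\<lambda>k. if k = p then 0 else 1 :: int)"
  have nz: "\<not> p dvd F (X k) (Y k)" for k
    using no has_root_infinity[of p a b c d] has_root_affine[of p a k b c d]
    by (auto simp: F_def X_def Y_def f)
  then have "\<exists>v w. F (X k) (Y k) * v = 1 + p * w" for k using mod_inverse[OF p] by metis
  then obtain v w where v: "\<And>k. F (X k) (Y k) * v k = 1 + p * w k" by metis
  define \<phi> where "\<phi> = (\<lambda>k. (G (X k) (Y k) * v k) mod p)"
  have "\<phi> ` {0..p} \<subseteq> {0..<p}" using p1 by (auto simp: \<phi>_def)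
  then have "card (\<phi> ` {0..p}) \<le> card {0..<p}" by (intro card_mono) auto
  then have "card (\<phi> ` {0..p}) < card {0..p}" using p1 by simp
  then have "\<not> inj_on \<phi> {0..p}" by (rule pigeonhole)
  then obtain i j where ij: "0 \<le> i" "i < j" "j \<le> p" "\<phi> i = \<phi> j"
    unfolding inj_on_def by (metis atLeastAtMost_iff linorder_neqE)
  have "p dvd G (X i) (Y i) * v i - G (X j) (Y j) * v j"
    using ij(4) by (simp add: \<phi>_def mod_eq_dvd_iff)
  then obtain m where m: "G (X i) (Y i) * v i - G (X j) (Y j) * v j = p * m" by (elim dvdE)
  define A where "A = G (X i) (Y i)"
  define B where "B = G (X j) (Y j)"
  define u where "u = F (X i) (Y i)"
  define u' where "u' = F (X j) (Y j)"
  have e: "u * v i = 1 + p * w i" "u' * v j = 1 + p * w j" "A * v i - B * v j = p * m"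
    using v m by (simp_all add: A_def B_def u_def u'_def)
  have "A * u' * (u * v i) - B * u * (u' * v j) = u * u' * (A * v i - B * v j)" by (simp add: algebra_simps)
  then have "A * u' - B * u = p * (u * u' * m - A * u' * w i + B * u * w j)"
    unfolding e by (simp add: algebra_simps)
  then have "p dvd 2 * (A * u' - B * u)" by simp
  moreover define T where "T = X i * Y j - X j * Y i"
  define S where "S = 2 * h0 * X i * X j + h1 * (X i * Y j + X j * Y i) + 2 * h2 * Y i * Y j"
  have "2 * (A * u' - B * u) = - T * (S^2 - D * T^2)"
    using key[of "X i" "Y i" "X j" "Y j"] by (simp add: A_def B_def u_def u'_def T_def S_def)
  ultimately have "p dvd T * (S^2 - D * T^2)" by simp
  then have "p dvd T \<or> p dvd S^2 - D * T^2" using p by (simp only: prime_dvd_mult_iff)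
  then have "p dvd T" using nonresidue_norm[OF p nr[folded D_def]] by blast
  moreover have "\<not> p dvd T"
  proof (cases "j = p")
    case True
    then show ?thesis using ij p1 by (auto simp: T_def X_def Y_def)
  next
    case False
    then have "T = i - j" using ij by (simp add: T_def X_def Y_def)
    moreover have "\<not> p dvd j - i" using ij False by (intro zdvd_not_zless) auto
    ultimately show ?thesis by (simp add: dvd_diff_commute)
  qed
  ultimately show False by simp
qed

text \<open>The two conditions say that the gradient of the form vanishes at \<open>(x, y)\<close> modulo
\<open>p\<close>. A matrix of determinant one moves this point to \<open>(0 : 1)\<close>; it suffices to
treat the points \<open>(r, 1)\<close> and \<open>(1, 0)\<close>.\<close>

lemma double_root_point:
  assumes p: "prime p" "\<not> p dvd 3"
    and Fu: "p dvd 3 * a * x^2 + 2 * b * x * y + c * y^2"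
    and Fv: "p dvd b * x^2 + 2 * c * x * y + 3 * d * y^2"
    and xy: "\<not> (p dvd x \<and> p dvd y)"
  shows "\<exists>A B C E. form_equiv (Cubic a b c d) (Cubic A B (p * C) (p * E))"
proof (cases "p dvd y")
  case False
  then obtain y' k where k: "y * y' = 1 + p * k" using mod_inverse[OF p(1)] by blast
  define r where "r = x * y'"
  have ry: "r * y = x + p * (k * x)" using k by (simp add: r_def algebra_simps)
  obtain m where m: "3 * a * x^2 + 2 * b * x * y + c * y^2 = p * m" using Fu by (elim dvdE)
  obtain n where n: "b * x^2 + 2 * c * x * y + 3 * d * y^2 = p * n" using Fv by (elim dvdE)
  have u: "p dvd 3 * a * r^2 + 2 * b * r + c"
  proof -
    have "y^2 * (3 * a * r^2 + 2 * b * r + c) = 3 * a * (r * y)^2 + 2 * b * (r * y) * y + c * y^2"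
      by (simp add: algebra_simps power2_eq_square)
    also have "\<dots> = p * m + p * (3 * a * (2 * k * x^2 + p * k^2 * x^2) + 2 * b * k * x * y)"
      unfolding ry m[symmetric] by (simp add: algebra_simps power2_eq_square)
    finally have "p dvd y^2 * (3 * a * r^2 + 2 * b * r + c)" by simp
    then show ?thesis using False p(1) by (auto simp: prime_dvd_mult_iff dest: prime_dvd_power)
  qed
  have v: "p dvd b * r^2 + 2 * c * r + 3 * d"
  proof -
    have "y^2 * (b * r^2 + 2 * c * r + 3 * d) = b * (r * y)^2 + 2 * c * (r * y) * y + 3 * d * y^2"
      by (simp add: algebra_simps power2_eq_square)
    also have "\<dots> = p * n + p * (b * (2 * k * x^2 + p * k^2 * x^2) + 2 * c * k * x * y)"
      unfolding ry n[symmetric] by (simp add: algebra_simps power2_eq_square)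
    finally have "p dvd y^2 * (b * r^2 + 2 * c * r + 3 * d)" by simp
    then show ?thesis using False p(1) by (auto simp: prime_dvd_mult_iff dest: prime_dvd_power)
  qed
  have "p dvd r * (3 * a * r^2 + 2 * b * r + c) + (b * r^2 + 2 * c * r + 3 * d)"
    using u v by simp
  also have "\<dots> = 3 * (a * r^3 + b * r^2 + c * r + d)"
    by (simp add: algebra_simps power2_eq_square power3_eq_cube)
  finally have "p dvd a * r^3 + b * r^2 + c * r + d" using p by (simp only: prime_dvd_mult_iff) simp
  then obtain E where E: "a * r^3 + b * r^2 + c * r + d = p * E" by (elim dvdE)
  obtain C where C: "3 * a * r^2 + 2 * b * r + c = p * C" using u by (elim dvdE)
  have "cubic_act (mat2 1 0 r 1) (Cubic a b c d) = Cubic a (3 * a * r + b) (p * C) (p * E)"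
    unfolding C[symmetric] E[symmetric]
    by (subst cubic_act_mat2) (simp_all add: algebra_simps)
  then show ?thesis using form_equiv_mat2[of 1 1 0 r "Cubic a b c d"] by auto
next
  case True
  then have x: "\<not> p dvd x" using xy by simp
  have "p dvd 2 * b * x * y" "p dvd c * y^2" "p dvd 2 * c * x * y" "p dvd 3 * d * y^2"
    using True by (simp_all add: power2_eq_square)
  then have "p dvd 3 * a * x^2" "p dvd b * x^2"
    using Fu Fv by (simp_all add: dvd_add_left_iff)
  then have "p dvd a" using p x by (auto simp: prime_dvd_mult_iff dest: prime_dvd_power)
  have "p dvd b" using \<open>p dvd b * x^2\<close> p x by (auto simp: prime_dvd_mult_iff dest: prime_dvd_power)
  obtain A B where "a = p * A" "b = p * B" using \<open>p dvd a\<close> \<open>p dvd b\<close> by (elim dvdE)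
  then have "cubic_act (mat2 0 (-1) 1 0) (Cubic a b c d) = Cubic (- d) c (p * (- B)) (p * A)"
    by (subst cubic_act_mat2) simp_all
  then have "form_equiv (Cubic a b c d) (Cubic (- d) c (p * (- B)) (p * A))"
    using form_equiv_mat2[of 0 0 "-1" 1 "Cubic a b c d"] by simp
  then show ?thesis by blast
qed

text \<open>Modulo \<open>p\<close> the Hessian \<open>h0 u\<^sup>2 + h1 u v + h2 v\<^sup>2\<close> has discriminant
zero, and its double root is the double root of \<open>F\<close>: the Hessian is apolar to both partial
derivatives of \<open>F\<close>, so their values at \<open>(- h1, 2 h0)\<close> are multiples of
\<open>h1\<^sup>2 - 4 h0 h2 = -3 Disc(F)\<close>. If the Hessian vanishes modulo \<open>p\<close>, then
\<open>F\<close> is proportional to a cube there, and the triple root can be read off.\<close>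

lemma double_root_exists:
  assumes p: "prime p" "\<not> p dvd 6" and D: "p dvd cubic_disc F"
  shows "\<exists>A B C E. form_equiv F (Cubic A B (p * C) (p * E))"
proof -
  obtain a b c d where F: "F = Cubic a b c d" by (cases F)
  have p2: "\<not> p dvd 2" using p(2) dvd_trans[of p 2 6] by auto
  have p3: "\<not> p dvd 3" using p(2) dvd_trans[of p 3 6] by auto
  define h0 where "h0 = b^2 - 3 * a * c"
  define h1 where "h1 = b * c - 9 * a * d"
  define h2 where "h2 = c^2 - 3 * b * d"
  obtain k where k: "cubic_disc F = p * k" using D by (elim dvdE)
  have hd: "h1^2 - 4 * h0 * h2 = - 3 * cubic_disc F"
    unfolding F h0_def h1_def h2_def by (simp add: algebra_simps power2_eq_square power3_eq_cube)
  have apolar: "3 * a * h2 - b * h1 + c * h0 = 0" "b * h2 - c * h1 + 3 * d * h0 = 0"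
    unfolding h0_def h1_def h2_def by (simp_all add: algebra_simps power2_eq_square)
  show ?thesis
  proof (cases "p dvd h0")
    case False
    have "3 * a * (- h1)^2 + 2 * b * (- h1) * (2 * h0) + c * (2 * h0)^2 = 3 * a * (h1^2 - 4 * h0 * h2)"
      using apolar(1) by algebra
    moreover have "b * (- h1)^2 + 2 * c * (- h1) * (2 * h0) + 3 * d * (2 * h0)^2 = b * (h1^2 - 4 * h0 * h2)"
      using apolar(2) by algebra
    ultimately show ?thesis unfolding F
      using D p2 False p by (intro double_root_point[of p a "- h1" b "2 * h0"]) (auto simp: hd p3 prime_dvd_mult_iff)
  next
    case h0: True
    have "p dvd h1^2 - 4 * h0 * h2" using D hd by simp
    moreover have "p dvd 4 * h0 * h2" using h0 by simp
    ultimately have "p dvd h1^2" using dvd_add[of p "h1^2 - 4 * h0 * h2" "4 * h0 * h2"] by simp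
    then have h1: "p dvd h1" using p(1) by (auto dest: prime_dvd_power)
    show ?thesis
    proof (cases "p dvd h2")
      case False
      have "3 * a * h2 = b * h1 - c * h0" using apolar(1) by simp
      then have "p dvd 3 * a * h2" using h0 h1 by simp
      then have a: "p dvd a" using False p3 p(1) by (simp add: prime_dvd_mult_iff)
      have "b * h2 = c * h1 - 3 * d * h0" using apolar(2) by simp
      then have "p dvd b * h2" using h0 h1 by simp
      then have b: "p dvd b" using False p3 p(1) by (simp add: prime_dvd_mult_iff)
      show ?thesis unfolding F
        using a b p p3 by (intro double_root_point[of p a 1 b 0]) (auto dest: not_prime_unit)
    next
      case h2: True
      show ?thesis
      proof (cases "p dvd a")
        case False
        have "3 * a * (- b)^2 + 2 * b * (- b) * (3 * a) + c * (3 * a)^2 = - (3 * a * h0)"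
          unfolding h0_def by algebra
        moreover have "b * (- b)^2 + 2 * c * (- b) * (3 * a) + 3 * d * (3 * a)^2 = b * h0 - 3 * a * h1"
          unfolding h0_def h1_def by algebra
        ultimately show ?thesis unfolding F
          using h0 h1 False p3 p(1)
          by (intro double_root_point[of p a "- b" b "3 * a"]) (auto simp: prime_dvd_mult_iff)
      next
        case True
        have "b^2 = h0 + 3 * a * c" by (simp add: h0_def)
        then have "p dvd b^2" using True h0 by simp
        then have "p dvd b" using p(1) by (auto dest: prime_dvd_power)
        then show ?thesis unfolding F
          using True p p3 by (intro double_root_point[of p a 1 b 0]) (auto dest: not_prime_unit)
      qed
    qed
  qed
qed

text \<open>With the double root at \<open>(0 : 1)\<close>, the form \<open>A u\<^sup>3 + B u\<^sup>2v + p C u v\<^sup>2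
+ p E v\<^sup>3\<close> has discriminant congruent to \<open>-4 p B\<^sup>3 E\<close> modulo
\<open>p\<^sup>2\<close>. So \<open>p\<close> divides \<open>E\<close>, which is the claim, or
\<open>B\<close>. In the second case the ring is totally ramified and \<open>D \<equiv> -27 A\<^sup>2
E\<^sup>2\<close>, which is a square modulo \<open>p\<close> because \<open>(2 z + 1)\<^sup>2 \<equiv>
-3\<close>.\<close>

lemma subring_form_if_disc_square_mult:
  assumes p: "prime p" "\<not> p dvd 6" and nr: "nonresidue p D" and z: "p dvd z^2 + z + 1"
    and F: "cubic_disc F = p^2 * D"
  shows "\<exists>t. form_equiv F (subring_form p t)"
proof -
  obtain A B C E where eq: "form_equiv F (Cubic A B (p * C) (p * E))"
    using double_root_exists[OF p, of F] F by auto
  have p0: "p \<noteq> 0" using p by auto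
  have p2: "\<not> p dvd 2" using p(2) dvd_trans[of p 2 6] by auto
  have disc: "cubic_disc (Cubic A B (p * C) (p * E)) = p^2 * D" using form_equiv_disc[OF eq] F by simp
  show ?thesis
  proof (cases "p dvd E")
    case True
    then obtain E' where "E = p * E'" by (elim dvdE)
    then have "Cubic A B (p * C) (p * E) = subring_form p (Cubic A B C E')" by (simp add: power2_eq_square)
    then show ?thesis using eq by metis
  next
    case False
    have "p * (p * (B^2 * C^2 - 4 * A * p * C^3 - 27 * A^2 * E^2 + 18 * A * B * C * E - D)) = p * (4 * B^3 * E)"
      using disc unfolding cubic_disc.simps by algebra
    then have e: "p * (B^2 * C^2 - 4 * A * p * C^3 - 27 * A^2 * E^2 + 18 * A * B * C * E - D) = 4 * B^3 * E"
      using p0 by simp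
    then have "p dvd 4 * B^3 * E" by (metis dvd_triv_left)
    moreover have "\<not> p dvd 4" using p2 p(1) prime_dvd_mult_iff[of p 2 2] by simp
    ultimately have "p dvd B" using False p(1) by (auto simp: prime_dvd_mult_iff dest: prime_dvd_power)
    then obtain B' where B: "B = p * B'" by (elim dvdE)
    have "p * (p * (p * B'^2 * C^2 - 4 * A * C^3 + 18 * A * B' * C * E - 4 * p * B'^3 * E) - (27 * A^2 * E^2 + D)) = 0"
      using e unfolding B by algebra
    then have e2: "27 * A^2 * E^2 + D = p * (p * B'^2 * C^2 - 4 * A * C^3 + 18 * A * B' * C * E - 4 * p * B'^3 * E)"
      using p0 by simp
    obtain m where m: "z^2 + z + 1 = p * m" using z by (elim dvdE)
    have "(3 * A * E * (2 * z + 1))^2 - D = 36 * A^2 * E^2 * (z^2 + z + 1) - (27 * A^2 * E^2 + D)"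
      by (simp add: algebra_simps power2_eq_square)
    also have "p dvd \<dots>" unfolding m e2 by simp
    finally show ?thesis using nr by (simp add: nonresidue_def)
  qed
qed

section \<open>Finiteness of the class number\<close>

definition coeff_box :: "int \<Rightarrow> cubic set" where
  "coeff_box N = {Cubic a b c d | a b c d. \<bar>a\<bar> \<le> N \<and> \<bar>b\<bar> \<le> N \<and> \<bar>c\<bar> \<le> N \<and> \<bar>d\<bar> \<le> N}"

lemma finite_coeff_box: "finite (coeff_box N)"
proof -
  have "coeff_box N = (\<lambda>(a, b, c, d). Cubic a b c d) ` ({-N..N} \<times> {-N..N} \<times> {-N..N} \<times> {-N..N})"
  proof (intro Set.set_eqI iffI)
    fix f assume "f \<in> coeff_box N"
    then obtain a b c d where "f = Cubic a b c d" "\<bar>a\<bar> \<le> N" "\<bar>b\<bar> \<le> N" "\<bar>c\<bar> \<le> N" "\<bar>d\<bar> \<le> N"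
      by (auto simp: coeff_box_def)
    then show "f \<in> (\<lambda>(a, b, c, d). Cubic a b c d) ` ({-N..N} \<times> {-N..N} \<times> {-N..N} \<times> {-N..N})"
      by (intro image_eqI[of _ _ "(a, b, c, d)"]) auto
  qed (auto simp: coeff_box_def)
  then show ?thesis by simp
qed

lemma coeff_box_mono: "M \<le> N \<Longrightarrow> coeff_box M \<subseteq> coeff_box N"
  by (force simp: coeff_box_def)

lemma abs_le_square: "\<bar>x\<bar> \<le> x^2" for x :: int
proof (cases "x = 0")
  case False
  then have "1 * \<bar>x\<bar> \<le> \<bar>x\<bar> * \<bar>x\<bar>" by (intro mult_right_mono) auto
  then show ?thesis by (simp add: power2_eq_square)
qed simp

text \<open>Gauss reduction for real coefficients: \<open>(p, q)\<close> is a shortest nonzero integer vector, which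
exists because only finitely many integer vectors are shorter than a given bound, and it is completed to a
basis whose second vector is shifted by a multiple of the first.\<close>

lemma reduce_definite_form:
  fixes A B C :: real
  assumes A: "A > 0" and disc: "B^2 < 4 * A * C"
  obtains p q r s :: int where "p * s - q * r = 1"
    "\<bar>2 * A * p * r + B * (p * s + q * r) + 2 * C * q * s\<bar> \<le> A * p^2 + B * p * q + C * q^2"
    "A * p^2 + B * p * q + C * q^2 \<le> A * r^2 + B * r * s + C * s^2"
    "A * p^2 + B * p * q + C * q^2 > 0"
proof -
  define Q where "Q = (\<lambda>v :: int \<times> int. A * of_int (fst v)^2 + B * of_int (fst v) * of_int (snd v) + C * of_int (snd v)^2)"
  define \<Delta> where "\<Delta> = 4 * A * C - B^2"
  have \<Delta>: "\<Delta> > 0" using disc by (simp add: \<Delta>_def)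
  have C: "C > 0"
  proof -
    have "0 < 4 * A * C" using disc zero_le_power2[of B] by linarith
    then show ?thesis using A by (simp add: zero_less_mult_iff)
  qed
  have e1: "4 * A * Q (x, y) = (2 * A * x + B * y)^2 + \<Delta> * of_int y^2" for x y :: int
    by (simp add: Q_def \<Delta>_def algebra_simps power2_eq_square)
  have e2: "4 * C * Q (x, y) = (2 * C * y + B * x)^2 + \<Delta> * of_int x^2" for x y :: int
    by (simp add: Q_def \<Delta>_def algebra_simps power2_eq_square)
  have pos: "Q v > 0" if "v \<noteq> (0, 0)" for v
  proof (cases v)
    case (Pair x y)
    show ?thesis
    proof (cases "y = 0")
      case True
      then show ?thesis using A that Pair by (simp add: Q_def)
    next
      case False
      then have "4 * A * Q (x, y) > 0" using e1[of x y] \<Delta> by (simp add: add_nonneg_pos)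
      then show ?thesis using A Pair by (simp add: zero_less_mult_iff)
    qed
  qed
  define m where "m = \<lceil>4 * A * A / \<Delta>\<rceil> + \<lceil>4 * C * A / \<Delta>\<rceil>"
  define V where "V = {v. v \<noteq> (0, 0) \<and> Q v \<le> A}"
  have "V \<subseteq> {-m..m} \<times> {-m..m}"
  proof
    fix v assume v: "v \<in> V"
    obtain x y where xy: "v = (x, y)" by (cases v)
    have Q: "Q (x, y) \<le> A" using v xy by (simp add: V_def)
    have "\<Delta> * of_int y^2 \<le> 4 * A * A" using e1[of x y] Q A
      by (smt (verit) mult_left_mono zero_le_power2)
    then have y: "of_int (y^2) \<le> 4 * A * A / \<Delta>" using \<Delta> by (simp add: field_simps)
    have "\<Delta> * of_int x^2 \<le> 4 * C * A" using e2[of x y] Q C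
      by (smt (verit) mult_left_mono zero_le_power2)
    then have x: "of_int (x^2) \<le> 4 * C * A / \<Delta>" using \<Delta> by (simp add: field_simps)
    have "0 \<le> 4 * A * A / \<Delta>" "0 \<le> 4 * C * A / \<Delta>" using A C \<Delta> by auto
    moreover have "y^2 \<le> \<lceil>4 * A * A / \<Delta>\<rceil>" "x^2 \<le> \<lceil>4 * C * A / \<Delta>\<rceil>" using x y by linarith+
    ultimately have "y^2 \<le> m" "x^2 \<le> m" unfolding m_def by linarith+
    then have "\<bar>x\<bar> \<le> m" "\<bar>y\<bar> \<le> m" using abs_le_square[of x] abs_le_square[of y] by linarith+
    then show "v \<in> {-m..m} \<times> {-m..m}" using xy by auto
  qed
  then have "finite V" by (rule finite_subset) simp
  moreover have "(1, 0) \<in> V" by (simp add: V_def Q_def)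
  ultimately have "\<exists>v. is_arg_min Q (\<lambda>v. v \<in> V) v"
    by (intro ex_is_arg_min_if_finite) auto
  then obtain v where v: "v \<in> V" and minV: "\<And>w. w \<in> V \<Longrightarrow> Q v \<le> Q w"
    by (auto simp: is_arg_min_def not_less)
  have min: "Q v \<le> Q w" if "w \<noteq> (0, 0)" for w
    using minV[of w] v that by (cases "w \<in> V") (auto simp: V_def)
  obtain p q where pq: "v = (p, q)" by (cases v)
  have v0: "(p, q) \<noteq> (0, 0)" using v pq by (auto simp: V_def)
  have "coprime p q"
  proof (rule ccontr)
    assume "\<not> coprime p q"
    define g where "g = gcd p q"
    have "g \<noteq> 1" using \<open>\<not> coprime p q\<close> by (simp add: g_def coprime_iff_gcd_eq_1)
    moreover have "g > 0" using v0 by (auto simp: g_def)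
    ultimately have g: "g > 1" by linarith
    obtain x y where xy: "p = g * x" "q = g * y" by (metis g_def dvdE gcd_dvd1 gcd_dvd2)
    have xy0: "(x, y) \<noteq> (0, 0)" using xy v0 by auto
    have "Q (p, q) = of_int g^2 * Q (x, y)" by (simp add: Q_def xy algebra_simps power2_eq_square)
    moreover have "of_int g^2 > (1 :: real)" using g by simp
    ultimately have "Q (p, q) > Q (x, y)" using pos[OF xy0] by simp
    then show False using min[OF xy0] pq by simp
  qed
  then obtain s0 r0 where "p * s0 + q * r0 = 1"
    by (metis bezout_int coprime_iff_gcd_eq_1 mult.commute)
  then have det0: "p * s0 - q * (- r0) = 1" by simp
  define a where "a = Q (p, q)"
  have a: "a > 0" using pos[OF v0] by (simp add: a_def)
  define b0 where "b0 = 2 * A * p * (- r0) + B * (p * s0 + q * (- r0)) + 2 * C * q * s0"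
  \<comment> \<open>the shift by k changes the middle coefficient by 2 a k\<close>
  define k where "k = round (- b0 / (2 * a))"
  define r where "r = - r0 + k * p"
  define s where "s = s0 + k * q"
  have det: "p * s - q * r = 1" using det0 by (simp add: r_def s_def algebra_simps)
  have b: "2 * A * p * r + B * (p * s + q * r) + 2 * C * q * s = b0 + 2 * a * k"
    by (simp add: r_def s_def b0_def a_def Q_def algebra_simps power2_eq_square)
  have "\<bar>of_int k - (- b0 / (2 * a))\<bar> \<le> 1 / 2" unfolding k_def by (rule of_int_round_abs_le)
  then have "2 * a * \<bar>of_int k - (- b0 / (2 * a))\<bar> \<le> 2 * a * (1 / 2)" using a by (intro mult_left_mono) auto
  moreover have "2 * a * \<bar>of_int k - (- b0 / (2 * a))\<bar> = \<bar>2 * a * (of_int k - (- b0 / (2 * a)))\<bar>"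
    using a by (simp add: abs_mult)
  moreover have "2 * a * (of_int k - (- b0 / (2 * a))) = b0 + 2 * a * k" using a by (simp add: field_simps)
  ultimately have "\<bar>b0 + 2 * a * k\<bar> \<le> a" by simp
  moreover have "(r, s) \<noteq> (0, 0)" using det by auto
  then have "a \<le> Q (r, s)" using min pq by (simp add: a_def)
  ultimately show thesis
    using that[OF det] a unfolding b by (simp add: a_def Q_def)
qed

fun hess0 :: "cubic \<Rightarrow> int" where "hess0 (Cubic a b c d) = b^2 - 3 * a * c"
fun hess1 :: "cubic \<Rightarrow> int" where "hess1 (Cubic a b c d) = b * c - 9 * a * d"
fun hess2 :: "cubic \<Rightarrow> int" where "hess2 (Cubic a b c d) = c^2 - 3 * b * d"

lemma hess_disc: "(hess1 f)^2 - 4 * hess0 f * hess2 f = - 3 * cubic_disc f"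
  by (cases f) (simp add: algebra_simps power2_eq_square power3_eq_cube)

lemma hess0_act:
  assumes "p * s - q * r = 1"
  shows "hess0 (cubic_act (mat2 p q r s) f) = hess0 f * p^2 + hess1 f * p * q + hess2 f * q^2"
proof (cases f)
  case (Cubic a b c d)
  have "hess0 (cubic_act (mat2 p q r s) f)
      = (p * s - q * r)^2 * (hess0 f * p^2 + hess1 f * p * q + hess2 f * q^2)"
    unfolding Cubic cubic_act_mat2[OF assms] hess0.simps hess1.simps hess2.simps by algebra
  then show ?thesis using assms by simp
qed

lemma hess1_act:
  assumes "p * s - q * r = 1"
  shows "hess1 (cubic_act (mat2 p q r s) f)
    = 2 * hess0 f * p * r + hess1 f * (p * s + q * r) + 2 * hess2 f * q * s"
proof (cases f)
  case (Cubic a b c d)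
  have "hess1 (cubic_act (mat2 p q r s) f)
      = (p * s - q * r)^2 * (2 * hess0 f * p * r + hess1 f * (p * s + q * r) + 2 * hess2 f * q * s)"
    unfolding Cubic cubic_act_mat2[OF assms] hess0.simps hess1.simps hess2.simps by algebra
  then show ?thesis using assms by simp
qed

lemma hess2_act:
  assumes "p * s - q * r = 1"
  shows "hess2 (cubic_act (mat2 p q r s) f) = hess0 f * r^2 + hess1 f * r * s + hess2 f * s^2"
proof (cases f)
  case (Cubic a b c d)
  have "hess2 (cubic_act (mat2 p q r s) f)
      = (p * s - q * r)^2 * (hess0 f * r^2 + hess1 f * r * s + hess2 f * s^2)"
    unfolding Cubic cubic_act_mat2[OF assms] hess0.simps hess1.simps hess2.simps by algebra
  then show ?thesis using assms by simp
qed

text \<open>The syzygy \<open>G\<^sup>2 + 27 Disc(f) f\<^sup>2 = 4 H\<^sup>3\<close> of the covariants of a cubic form,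
at the point \<open>(1, 0)\<close>.\<close>

lemma lead_coeff_le_hess0:
  "27 * cubic_disc (Cubic a b c d) * a^2 \<le> 4 * (hess0 (Cubic a b c d))^3"
proof -
  have "4 * (hess0 (Cubic a b c d))^3 - 27 * cubic_disc (Cubic a b c d) * a^2
      = (2 * b^3 - 9 * a * b * c + 27 * a^2 * d)^2"
    unfolding hess0.simps cubic_disc.simps by algebra
  then show ?thesis using zero_le_power2[of "2 * b^3 - 9 * a * b * c + 27 * a^2 * d"] by linarith
qed

text \<open>A bound on the Hessian at a primitive vector bounds the form there: move the vector to \<open>(1,
0)\<close>.\<close>

lemma value_bound:
  assumes D: "D > 0" "cubic_disc (Cubic a b c d) = D" and det: "p * s - q * r = 1"
    and H: "hess0 (cubic_act (mat2 p q r s) (Cubic a b c d)) \<le> 3 * D"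
  shows "\<bar>a * p^3 + b * p^2 * q + c * p * q^2 + d * q^3\<bar> \<le> 2 * D"
proof -
  define f' where "f' = cubic_act (mat2 p q r s) (Cubic a b c d)"
  define x where "x = a * p^3 + b * p^2 * q + c * p * q^2 + d * q^3"
  obtain b' c' d' where f': "f' = Cubic x b' c' d'"
    unfolding f'_def cubic_act_mat2[OF det] x_def by blast
  have "cubic_disc f' = D"
    using form_equiv_disc[OF form_equiv_mat2[OF det]] D(2) unfolding f'_def by metis
  then have le: "27 * D * x^2 \<le> 4 * (hess0 f')^3" using lead_coeff_le_hess0[of x b' c' d'] f' by simp
  moreover have "(hess0 f')^3 \<le> (3 * D)^3"
    using H by (intro power_mono_odd) (simp_all add: f'_def)
  ultimately have "27 * D * x^2 \<le> 27 * D * (2 * D)^2" by (simp add: power3_eq_cube power2_eq_square)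
  then have "x^2 \<le> (2 * D)^2" using D by simp
  then have "\<bar>x\<bar> \<le> \<bar>2 * D\<bar>" unfolding abs_le_square_iff .
  then show ?thesis using D unfolding x_def[symmetric] by simp
qed

text \<open>For \<open>D > 0\<close> the Hessian is positive definite of discriminant \<open>-3 D\<close>. Once it is
reduced, its coefficients are at most \<open>D\<close>, so its values at \<open>(1, 0)\<close>, \<open>(0,
1)\<close>, \<open>(1, 1)\<close>, \<open>(1, -1)\<close> are at most \<open>3 D\<close>, which bounds the
values of the cubic form at these four points and hence its coefficients.\<close>

lemma reduce_positive_disc:
  assumes D: "D > 0" "cubic_disc f = D"
  shows "\<exists>f'\<in>coeff_box (4 * D). form_equiv f f'"
proof -
  obtain a b c d where f: "f = Cubic a b c d" by (cases f)
  have h: "(hess1 f)^2 + 3 * D = 4 * hess0 f * hess2 f" using hess_disc[of f] D by simp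
  have "0 \<le> 27 * D * a^2" using D by simp
  also have "\<dots> \<le> 4 * (hess0 f)^3" using lead_coeff_le_hess0[of a b c d] unfolding f[symmetric] D(2) .
  finally have "0 \<le> hess0 f" by (simp add: zero_le_power_eq)
  moreover have "hess0 f \<noteq> 0" using h D by (auto simp: add_nonneg_eq_0_iff)
  ultimately have h0: "real_of_int (hess0 f) > 0" by simp
  have "(hess1 f)^2 < 4 * hess0 f * hess2 f" using h D by linarith
  then have "real_of_int ((hess1 f)^2) < real_of_int (4 * hess0 f * hess2 f)" by (simp only: of_int_less_iff)
  then have hd: "(of_int (hess1 f))^2 < 4 * real_of_int (hess0 f) * of_int (hess2 f)" by simp
  obtain p q r s :: int where det: "p * s - q * r = 1"
    and "\<bar>2 * real_of_int (hess0 f) * p * r + real_of_int (hess1 f) * (p * s + q * r) + 2 * real_of_int (hess2 f) * q * s\<bar>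
        \<le> real_of_int (hess0 f) * p^2 + real_of_int (hess1 f) * p * q + real_of_int (hess2 f) * q^2"
    and "real_of_int (hess0 f) * p^2 + real_of_int (hess1 f) * p * q + real_of_int (hess2 f) * q^2
        \<le> real_of_int (hess0 f) * r^2 + real_of_int (hess1 f) * r * s + real_of_int (hess2 f) * s^2"
    and "real_of_int (hess0 f) * p^2 + real_of_int (hess1 f) * p * q + real_of_int (hess2 f) * q^2 > 0"
    by (rule reduce_definite_form[OF h0 hd])
  then have "real_of_int \<bar>hess1 (cubic_act (mat2 p q r s) f)\<bar> \<le> of_int (hess0 (cubic_act (mat2 p q r s) f))"
    "real_of_int (hess0 (cubic_act (mat2 p q r s) f)) \<le> of_int (hess2 (cubic_act (mat2 p q r s) f))"
    "real_of_int (hess0 (cubic_act (mat2 p q r s) f)) > 0"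
    unfolding hess0_act[OF det] hess1_act[OF det] hess2_act[OF det] by simp_all
  then have red: "\<bar>hess1 (cubic_act (mat2 p q r s) f)\<bar> \<le> hess0 (cubic_act (mat2 p q r s) f)"
    "hess0 (cubic_act (mat2 p q r s) f) \<le> hess2 (cubic_act (mat2 p q r s) f)"
    "hess0 (cubic_act (mat2 p q r s) f) > 0" by simp_all
  define f' where "f' = cubic_act (mat2 p q r s) f"
  have eq: "form_equiv f f'" unfolding f'_def by (rule form_equiv_mat2[OF det])
  have D': "cubic_disc f' = D" using form_equiv_disc[OF eq] D by simp
  note red = red[folded f'_def]
  have "(hess1 f')^2 \<le> (hess0 f')^2" using red by (metis abs_ge_zero power_mono power2_abs)
  also have "\<dots> \<le> hess0 f' * hess2 f'" unfolding power2_eq_square using red by (intro mult_left_mono) auto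
  finally have "hess0 f' * hess2 f' \<le> D" using hess_disc[of f'] D' by linarith
  moreover have "1 * hess2 f' \<le> hess0 f' * hess2 f'" using red by (intro mult_right_mono) auto
  ultimately have le: "hess2 f' \<le> D" "hess0 f' \<le> D" "\<bar>hess1 f'\<bar> \<le> D" using red by linarith+
  obtain a' b' c' d' where f': "f' = Cubic a' b' c' d'" by (cases f')
  have 1: "\<bar>a'\<bar> \<le> 2 * D"
    using value_bound[of D a' b' c' d' 1 1 0 0] hess0_act[of 1 1 0 0 f'] D D' le by (simp add: f' mult_ac)
  have 2: "\<bar>d'\<bar> \<le> 2 * D"
    using value_bound[of D a' b' c' d' 0 0 1 "-1"] hess0_act[of 0 0 1 "-1" f'] D D' le by (simp add: f' mult_ac)
  have 3: "\<bar>a' + b' + c' + d'\<bar> \<le> 2 * D"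
    using value_bound[of D a' b' c' d' 1 1 1 0] hess0_act[of 1 1 1 0 f'] D D' le by (simp add: f' mult_ac)
  have 4: "\<bar>a' - b' + c' - d'\<bar> \<le> 2 * D"
    using value_bound[of D a' b' c' d' 1 1 "-1" 0] hess0_act[of 1 1 "-1" 0 f'] D D' le by (simp add: f' mult_ac)
  have "\<bar>b'\<bar> \<le> 4 * D" "\<bar>c'\<bar> \<le> 4 * D" using 1 2 3 4 by linarith+
  then have "f' \<in> coeff_box (4 * D)" using 1 2 D f' by (auto simp: coeff_box_def)
  then show ?thesis using eq by blast
qed

text \<open>Here \<open>b\<^sup>2\<close> divides \<open>D\<close>, and \<open>u \<mapsto> u + k v\<close> changes
\<open>c\<close> by \<open>2 b k\<close>.\<close>

lemma reduce_reducible: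
  assumes D: "D \<noteq> 0" "cubic_disc (Cubic 0 b c d) = D"
  shows "\<exists>f'\<in>coeff_box (\<bar>D\<bar> + 4 * D^2). form_equiv (Cubic 0 b c d) f'"
proof -
  have disc: "b^2 * (c^2 - 4 * b * d) = D"
    using D(2) by (simp add: algebra_simps power2_eq_square power3_eq_cube)
  define k where "k = - (c div (2 * b))"
  define c' where "c' = c + 2 * b * k"
  define d' where "d' = b * k^2 + c * k + d"
  have act: "cubic_act (mat2 1 0 k 1) (Cubic 0 b c d) = Cubic 0 b c' d'"
    by (subst cubic_act_mat2) (simp_all add: c'_def d'_def)
  have eq: "form_equiv (Cubic 0 b c d) (Cubic 0 b c' d')"
    using form_equiv_mat2[of 1 1 0 k "Cubic 0 b c d"] act by simp
  have disc': "b^2 * (c'^2 - 4 * b * d') = D"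
    using disc by (simp add: c'_def d'_def algebra_simps power2_eq_square)
  have b0: "b \<noteq> 0" using disc D by auto
  have c'm: "c' = c mod (2 * b)" by (simp add: c'_def k_def minus_div_mult_eq_mod[symmetric] algebra_simps)
  have "\<bar>c'\<bar> \<le> 2 * \<bar>b\<bar>" using c'm b0 abs_mod_less[of "2 * b" c] by simp
  have "\<bar>D\<bar> \<ge> b^2" using disc' D(1) dvd_imp_le_int[of D "b^2"] by (metis abs_of_nonneg dvd_triv_left zero_le_power2)
  have b: "\<bar>b\<bar> \<le> \<bar>D\<bar>" using abs_le_square[of b] \<open>\<bar>D\<bar> \<ge> b^2\<close> by linarith
  have "\<bar>c'^2 - 4 * b * d'\<bar> \<le> \<bar>D\<bar>"
    using disc' D(1) dvd_imp_le_int[of D "c'^2 - 4 * b * d'"] by (metis dvd_triv_right)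
  then have "\<bar>4 * b * d'\<bar> \<le> \<bar>D\<bar> + c'^2" using zero_le_power2[of c'] by linarith
  moreover have "c'^2 \<le> (2 * D)^2"
    unfolding abs_le_square_iff[symmetric] using \<open>\<bar>c'\<bar> \<le> 2 * \<bar>b\<bar>\<close> b by simp
  moreover have "\<bar>4 * b * d'\<bar> \<ge> \<bar>d'\<bar>"
  proof -
    have "1 * \<bar>d'\<bar> \<le> \<bar>4 * b\<bar> * \<bar>d'\<bar>" using b0 by (intro mult_right_mono) auto
    then show ?thesis by (simp add: abs_mult)
  qed
  ultimately have d: "\<bar>d'\<bar> \<le> \<bar>D\<bar> + 4 * D^2" by (simp add: power2_eq_square)
  have "\<bar>D\<bar> \<le> D^2" by (rule abs_le_square)
  then have "\<bar>c'\<bar> \<le> \<bar>D\<bar> + 4 * D^2" "\<bar>b\<bar> \<le> \<bar>D\<bar> + 4 * D^2"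
    using \<open>\<bar>c'\<bar> \<le> 2 * \<bar>b\<bar>\<close> b by linarith+
  then have "Cubic 0 b c' d' \<in> coeff_box (\<bar>D\<bar> + 4 * D^2)" using d by (auto simp: coeff_box_def)
  then show ?thesis using eq by blast
qed


lemma monic_cubic_real_root:
  fixes b c d :: real
  shows "\<exists>x. x^3 + b * x^2 + c * x + d = 0"
proof -
  define M where "M = 1 + \<bar>b\<bar> + \<bar>c\<bar> + \<bar>d\<bar>"
  define g where "g = (\<lambda>x. x^3 + b * x^2 + c * x + d)"
  have M: "M \<ge> 1" by (simp add: M_def)
  have MM: "M^2 \<ge> M" "M^2 \<ge> 1" using M self_le_power[of M 2] by auto
  have small: "\<bar>b * x^2 + c * x + d\<bar> < M^3" if x: "\<bar>x\<bar> = M" for x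
  proof -
    have "\<bar>b * x^2 + c * x + d\<bar> \<le> \<bar>b * x^2\<bar> + \<bar>c * x\<bar> + \<bar>d\<bar>" by linarith
    also have "\<dots> = \<bar>b\<bar> * M^2 + \<bar>c\<bar> * M + \<bar>d\<bar> * 1" using x by (simp add: abs_mult flip: x)
    also have "\<dots> \<le> \<bar>b\<bar> * M^2 + \<bar>c\<bar> * M^2 + \<bar>d\<bar> * M^2"
      using MM by (intro add_mono mult_left_mono) auto
    also have "\<dots> = (M - 1) * M^2" by (simp add: M_def algebra_simps)
    also have "\<dots> < M * M^2" using M by (intro mult_strict_right_mono) auto
    finally show ?thesis by (simp add: power3_eq_cube power2_eq_square)
  qed
  have "g M \<ge> 0" using small[of M] M by (simp add: g_def)
  moreover have "g (- M) \<le> 0" using small[of "- M"] M by (simp add: g_def)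
  moreover have "\<forall>x. - M \<le> x \<and> x \<le> M \<longrightarrow> isCont g x" by (simp add: g_def)
  ultimately obtain x where "g x = 0" using IVT[of g "- M" 0 M] M by auto
  then show ?thesis by (auto simp: g_def)
qed

text \<open>The right-hand side of the last assumption is minus the discriminant of \<open>(r u + s v) (u\<^sup>2 + B u
v + C v\<^sup>2)\<close>, written as the discriminant of the quadratic factor times the square of a
resultant. For a reduced quadratic factor, \<open>s\<^sup>2 - B r s + C r\<^sup>2\<close> is at least half
of \<open>X = s\<^sup>2 + C r\<^sup>2\<close>.\<close>

lemma reduced_factorization_bound:
  fixes r s B C N :: real
  assumes r: "\<bar>r\<bar> \<ge> 1" and B: "\<bar>B\<bar> \<le> 1" and C: "C \<ge> 1"
    and N: "N = (4 * C - B^2) * (s^2 - B * r * s + C * r^2)^2"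
  shows "\<bar>r\<bar> \<le> 4 * N / 3 + 1" "\<bar>s\<bar> \<le> 4 * N / 3 + 1" "C \<le> 4 * N / 3 + 1"
proof -
  have "B^2 \<le> 1" using B by (simp add: abs_square_le_1)
  then have 1: "4 * C - B^2 \<ge> 3 * C" using C by linarith
  have "\<bar>B * r * s\<bar> \<le> \<bar>r * s\<bar>" using B by (simp add: abs_mult mult_left_le_one_le mult.assoc)
  also have "2 * \<bar>r * s\<bar> \<le> r^2 + s^2"
    using sum_squares_bound[of "\<bar>r\<bar>" "\<bar>s\<bar>"] by (simp add: abs_mult)
  finally have "2 * \<bar>B * r * s\<bar> \<le> r^2 + s^2" by simp
  moreover have "r^2 \<le> C * r^2" using C by (simp add: mult_le_cancel_right1)
  ultimately have 2: "s^2 - B * r * s + C * r^2 \<ge> (s^2 + C * r^2) / 2" by (simp add: abs_le_iff)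
  define X where "X = s^2 + C * r^2"
  have r2: "r^2 \<ge> 1" using r by (metis abs_ge_zero one_le_power power2_abs)
  have X: "X \<ge> C" "X \<ge> 0" "X \<ge> r^2" "X \<ge> s^2"
    using r2 C mult_left_mono[of 1 "r^2" C] \<open>r^2 \<le> C * r^2\<close> zero_le_power2[of s] zero_le_power2[of r]
    unfolding X_def by (linarith | simp)+
  have "(X / 2)^2 \<le> (s^2 - B * r * s + C * r^2)^2" using 2 X by (intro power_mono) (auto simp: X_def)
  then have "3 * C * (X / 2)^2 \<le> N" unfolding N using 1 C by (intro mult_mono) auto
  moreover have "3 * 1 * (X / 2)^2 \<le> 3 * C * (X / 2)^2" using C by (intro mult_right_mono) auto
  ultimately have X2: "X^2 \<le> 4 * N / 3" by (simp add: power_divide)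
  have "X \<ge> 1" using X C by linarith
  then have "X \<le> X^2" by (simp add: self_le_power)
  then have XN: "X \<le> 4 * N / 3" using X2 by linarith
  have abs: "\<bar>y\<bar> \<le> y^2 + 1" for y :: real
  proof (cases "\<bar>y\<bar> \<le> 1")
    case False
    then have "\<bar>y\<bar> \<le> \<bar>y\<bar>^2" by (intro self_le_power) auto
    then show ?thesis by simp
  qed (use zero_le_power2[of y] in linarith)
  show "\<bar>r\<bar> \<le> 4 * N / 3 + 1" "\<bar>s\<bar> \<le> 4 * N / 3 + 1" "C \<le> 4 * N / 3 + 1"
    using abs[of r] abs[of s] X XN by linarith+
qed

text \<open>For \<open>D < 0\<close> the Hessian is indefinite. Instead, a form with \<open>a \<noteq> 0\<close> has a
linear factor over the reals, the complementary quadratic factor is definite, and reducing the latter bounds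
all coefficients, unless the reduced form has leading coefficient zero and is covered by the reducible case.
The quadratic factor is kept monic, so that the linear factor has the same leading coefficient as the form,
a nonzero integer.\<close>

lemma reduce_negative_disc:
  assumes D: "D < 0" "cubic_disc f = D"
  shows "\<exists>f'\<in>coeff_box (100 * D^2). form_equiv f f'"
proof -
  obtain a b c d where f: "f = Cubic a b c d" by (cases f)
  have D1: "\<bar>D\<bar> \<ge> 1" "\<bar>D\<bar> \<le> D^2" using D(1) abs_le_square[of D] by auto
  have box0: "coeff_box (\<bar>D\<bar> + 4 * D^2) \<subseteq> coeff_box (100 * D^2)"
    by (rule coeff_box_mono) (use D1 in linarith)
  have reducible: "\<exists>f'\<in>coeff_box (100 * D^2). form_equiv f f'" if "form_equiv f (Cubic 0 b' c' d')" for b' c' d'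
  proof -
    have "cubic_disc (Cubic 0 b' c' d') = D" using form_equiv_disc[OF that] D by simp
    then obtain f' where "f' \<in> coeff_box (\<bar>D\<bar> + 4 * D^2)" "form_equiv (Cubic 0 b' c' d') f'"
      using reduce_reducible[of D b' c' d'] D by auto
    then show ?thesis using box0 form_equiv_trans[OF that] by blast
  qed
  show ?thesis
  proof (cases "a = 0")
    case True
    then show ?thesis using reducible[of b c d] f form_equiv_refl by simp
  next
    case False
    then have a0: "real_of_int a \<noteq> 0" by simp
    obtain \<theta> :: real where "\<theta>^3 + (b / a) * \<theta>^2 + (c / a) * \<theta> + d / a = 0"
      using monic_cubic_real_root by blast
    then have "real_of_int a * (\<theta>^3 + (b / a) * \<theta>^2 + (c / a) * \<theta> + d / a) = 0" by simp
    then have \<theta>: "a * \<theta>^3 + b * \<theta>^2 + c * \<theta> + d = 0"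
      using a0 by (simp add: distrib_left)
    define B where "B = b / a + \<theta>"
    define C where "C = c / a + \<theta> * B"
    have b: "real_of_int b = a * (B - \<theta>)" using a0 by (simp add: B_def)
    have c: "real_of_int c = a * (C - \<theta> * B)" using a0 by (simp add: C_def)
    have d: "real_of_int d = - (real_of_int a * (\<theta> * C))"
      using \<theta> unfolding b c by (simp add: algebra_simps power2_eq_square power3_eq_cube)
    have disc: "real_of_int D = (B^2 - 4 * C) * ((real_of_int a)^2 * (\<theta>^2 + B * \<theta> + C))^2"
    proof -
      have "real_of_int D = (real_of_int b)^2 * (real_of_int c)^2 - 4 * real_of_int a * (real_of_int c)^3
          - 4 * (real_of_int b)^3 * real_of_int d - 27 * (real_of_int a)^2 * (real_of_int d)^2
          + 18 * real_of_int a * real_of_int b * real_of_int c * real_of_int d"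
        unfolding D(2)[symmetric] f by simp
      also have "\<dots> = (B^2 - 4 * C) * ((real_of_int a)^2 * (\<theta>^2 + B * \<theta> + C))^2"
        unfolding b c d by algebra
      finally show ?thesis .
    qed
    have "(B^2 - 4 * C) < 0" using disc D(1)
      by (metis mult_nonneg_nonneg not_le of_int_0_less_iff of_int_less_0_iff zero_le_power2)
    then have BC: "B^2 < 4 * 1 * C" by simp
    obtain p q r s :: int where det: "p * s - q * r = 1"
      and red: "\<bar>2 * (1::real) * p * r + B * (p * s + q * r) + 2 * C * q * s\<bar> \<le> (1::real) * p^2 + B * p * q + C * q^2"
        "(1::real) * p^2 + B * p * q + C * q^2 \<le> (1::real) * r^2 + B * r * s + C * s^2"
        "(1::real) * p^2 + B * p * q + C * q^2 > 0"
      by (rule reduce_definite_form[OF zero_less_one BC])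
    define A' where "A' = p^2 + B * p * q + C * q^2"
    define B' where "B' = (2 * p * r + B * (p * s + q * r) + 2 * C * q * s) / A'"
    define C' where "C' = (r^2 + B * r * s + C * s^2) / A'"
    \<comment> \<open>rescaling by A' makes the transformed quadratic factor monic\<close>
    define u where "u = a * (p - \<theta> * q) * A'"
    define v where "v = a * (r - \<theta> * s) * A'"
    have A': "A' > 0" using red by (simp add: A'_def)
    obtain a' b' c' d' where act: "cubic_act (mat2 p q r s) f = Cubic a' b' c' d'"
      by (cases "cubic_act (mat2 p q r s) f")
    have eq: "form_equiv f (Cubic a' b' c' d')" using form_equiv_mat2[OF det, of f] act by simp
    have D': "cubic_disc (Cubic a' b' c' d') = D" using form_equiv_disc[OF eq] D by simp
    have AB: "A' * B' = 2 * p * r + B * (p * s + q * r) + 2 * C * q * s"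
      and AC: "A' * C' = r^2 + B * r * s + C * s^2" using A' by (simp_all add: B'_def C'_def)
    have cf: "a' = a * p^3 + b * p^2 * q + c * p * q^2 + d * q^3"
      "b' = 3 * a * p^2 * r + b * (p^2 * s + 2 * p * q * r) + c * (2 * p * q * s + q^2 * r) + 3 * d * q^2 * s"
      "c' = 3 * a * p * r^2 + b * (2 * p * r * s + q * r^2) + c * (p * s^2 + 2 * q * r * s) + 3 * d * q * s^2"
      "d' = a * r^3 + b * r^2 * s + c * r * s^2 + d * s^3"
      using act unfolding f cubic_act_mat2[OF det] by simp_all
    have a': "real_of_int a' = u"
      unfolding cf u_def A'_def of_int_add of_int_mult of_int_power of_int_numeral b c d by algebra
    have b': "real_of_int b' = u * B' + v"
    proof -
      have "u * B' = a * (p - \<theta> * q) * (A' * B')" by (simp add: u_def)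
      then have uB: "u * B' = a * (p - \<theta> * q) * (2 * p * r + B * (p * s + q * r) + 2 * C * q * s)"
        unfolding AB .
      show ?thesis
        unfolding uB v_def A'_def cf of_int_add of_int_mult of_int_power of_int_numeral b c d by algebra
    qed
    have c': "real_of_int c' = u * C' + v * B'"
    proof -
      have "u * C' + v * B' = a * (p - \<theta> * q) * (A' * C') + a * (r - \<theta> * s) * (A' * B')"
        by (simp add: u_def v_def)
      then have uv: "u * C' + v * B' = a * (p - \<theta> * q) * (r^2 + B * r * s + C * s^2)
          + a * (r - \<theta> * s) * (2 * p * r + B * (p * s + q * r) + 2 * C * q * s)"
        unfolding AB AC .
      show ?thesis
        unfolding uv cf of_int_add of_int_mult of_int_power of_int_numeral b c d by algebra
    qed
    have d': "real_of_int d' = v * C'"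
    proof -
      have "v * C' = a * (r - \<theta> * s) * (A' * C')" by (simp add: v_def)
      then have vC: "v * C' = a * (r - \<theta> * s) * (r^2 + B * r * s + C * s^2)" unfolding AC .
      show ?thesis
        unfolding vC cf of_int_add of_int_mult of_int_power of_int_numeral b c d by algebra
    qed
    show ?thesis
    proof (cases "a' = 0")
      case True
      then show ?thesis using reducible eq by simp
    next
      case False
      then have u1: "\<bar>u\<bar> \<ge> 1" using a' by linarith
      have B1: "\<bar>B'\<bar> \<le> 1" using red(1) A' by (simp add: B'_def A'_def)
      have C1: "C' \<ge> 1" using red(2) A' by (simp add: C'_def A'_def)
      have N: "- real_of_int D = (4 * C' - B'^2) * (v^2 - B' * u * v + C' * u^2)^2"
      proof -
        have "real_of_int D = (real_of_int b')^2 * (real_of_int c')^2 - 4 * real_of_int a' * (real_of_int c')^3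
            - 4 * (real_of_int b')^3 * real_of_int d' - 27 * (real_of_int a')^2 * (real_of_int d')^2
            + 18 * real_of_int a' * real_of_int b' * real_of_int c' * real_of_int d'"
          unfolding D'[symmetric] by simp
        also have "\<dots> = (B'^2 - 4 * C') * (v^2 - B' * u * v + C' * u^2)^2"
          unfolding a' b' c' d' by algebra
        finally show ?thesis by (simp add: algebra_simps)
      qed
      define M where "M = 4 * (- real_of_int D) / 3 + 1"
      have bd: "\<bar>u\<bar> \<le> M" "\<bar>v\<bar> \<le> M" "C' \<le> M"
        using reduced_factorization_bound[OF u1 B1 C1 N] by (auto simp: M_def)
      have M: "M \<ge> 1" using bd(1) u1 by linarith
      then have MM: "M \<le> M^2" by (simp add: self_le_power)
      have uB: "\<bar>u * B'\<bar> \<le> M" "\<bar>v * B'\<bar> \<le> M"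
        using mult_mono[of "\<bar>u\<bar>" M "\<bar>B'\<bar>" 1] mult_mono[of "\<bar>v\<bar>" M "\<bar>B'\<bar>" 1] bd B1 M
        by (simp_all add: abs_mult)
      have uC: "\<bar>u * C'\<bar> \<le> M^2" "\<bar>v * C'\<bar> \<le> M^2"
        using mult_mono[of "\<bar>u\<bar>" M "\<bar>C'\<bar>" M] mult_mono[of "\<bar>v\<bar>" M "\<bar>C'\<bar>" M] bd C1 M
        by (simp_all add: abs_mult power2_eq_square)
      have "real_of_int \<bar>a'\<bar> \<le> 2 * M^2" "real_of_int \<bar>b'\<bar> \<le> 2 * M^2"
        "real_of_int \<bar>c'\<bar> \<le> 2 * M^2" "real_of_int \<bar>d'\<bar> \<le> 2 * M^2"
        using a' b' c' d' bd uB uC MM M by linarith+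
      moreover have "2 * M^2 \<le> real_of_int (100 * D^2)"
      proof -
        have "M \<le> 7 * real_of_int \<bar>D\<bar>" using D1 D by (simp add: M_def)
        then have "M^2 \<le> (7 * real_of_int \<bar>D\<bar>)^2" using M by (intro power_mono) auto
        then have "M^2 \<le> 49 * (real_of_int D)^2" by (simp add: power_mult_distrib)
        moreover have "0 \<le> (real_of_int D)^2" by simp
        ultimately have "2 * M^2 \<le> 100 * (real_of_int D)^2" by linarith
        then show ?thesis by simp
      qed
      ultimately have "real_of_int \<bar>a'\<bar> \<le> real_of_int (100 * D^2)" "real_of_int \<bar>b'\<bar> \<le> real_of_int (100 * D^2)"
        "real_of_int \<bar>c'\<bar> \<le> real_of_int (100 * D^2)" "real_of_int \<bar>d'\<bar> \<le> real_of_int (100 * D^2)"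
        by linarith+
      then have "Cubic a' b' c' d' \<in> coeff_box (100 * D^2)"
        unfolding of_int_le_iff coeff_box_def by blast
      then show ?thesis using eq by blast
    qed
  qed
qed

lemma finite_disc_orbits:
  assumes "D \<noteq> 0"
  shows "finite (disc_orbits D)"
proof -
  have "\<exists>N. \<forall>f. cubic_disc f = D \<longrightarrow> (\<exists>f'\<in>coeff_box N. form_equiv f f')"
    using assms reduce_positive_disc reduce_negative_disc by (metis linorder_neqE)
  then obtain N where N: "\<And>f. cubic_disc f = D \<Longrightarrow> \<exists>f'\<in>coeff_box N. form_equiv f f'" by blast
  have "disc_orbits D \<subseteq> form_orbit ` coeff_box N"
    using N form_orbit_eq_iff by (force simp: disc_orbits_def)
  then show ?thesis using finite_coeff_box finite_subset by blast
qed

section \<open>The mass of a discriminant and of its product with a prime square\<close>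

text \<open>By elimination of the last equation, after a pivot has been moved to the last unknown.\<close>

lemma homogeneous_system_solution:
  fixes x :: "nat \<Rightarrow> nat \<Rightarrow> 'a :: field"
  shows "\<exists>\<alpha>. (\<exists>i\<le>k. \<alpha> i \<noteq> 0) \<and> (\<forall>l\<in>{1..k}. (\<Sum>i\<le>k. \<alpha> i * x i l) = 0)"
proof (induction k arbitrary: x)
  case 0
  show ?case by (intro exI[of _ "\<lambda>_. 1"]) auto
next
  case (Suc k)
  show ?case
  proof (cases "\<forall>i\<le>Suc k. x i (Suc k) = 0")
    case True
    obtain \<alpha> where \<alpha>: "\<exists>i\<le>k. \<alpha> i \<noteq> 0" "\<forall>l\<in>{1..k}. (\<Sum>i\<le>k. \<alpha> i * x i l) = 0"
      using Suc.IH[of x] by blast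
    define \<mu> where "\<mu> = \<alpha>(Suc k := 0)"
    have "(\<Sum>i\<le>Suc k. \<mu> i * x i l) = (\<Sum>i\<le>k. \<alpha> i * x i l)" for l
      by (simp add: \<mu>_def)
    moreover have "(\<Sum>i\<le>k. \<alpha> i * x i (Suc k)) = 0" using True by simp
    ultimately have "\<forall>l\<in>{1..Suc k}. (\<Sum>i\<le>Suc k. \<mu> i * x i l) = 0"
      using \<alpha>(2) by (auto simp: le_Suc_eq)
    moreover obtain i where "i \<le> k" "\<alpha> i \<noteq> 0" using \<alpha>(1) by blast
    then have "\<exists>i\<le>Suc k. \<mu> i \<noteq> 0" by (intro exI[of _ i]) (simp add: \<mu>_def)
    ultimately show ?thesis by blast
  next
    case False
    then obtain j where j: "j \<le> Suc k" "x j (Suc k) \<noteq> 0" by blast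
    define \<pi> where "\<pi> = (\<lambda>i. if i = j then Suc k else if i = Suc k then j else i)"
    have "bij_betw \<pi> {..Suc k} {..Suc k}"
      by (rule bij_betw_byWitness[of _ \<pi>]) (use j(1) in \<open>auto simp: \<pi>_def\<close>)
    then have \<pi>: "\<pi> (Suc k) = j" "\<And>i. \<pi> (\<pi> i) = i" "bij_betw \<pi> {..Suc k} {..Suc k}"
      by (auto simp: \<pi>_def)
    define y where "y = (\<lambda>i l. x (\<pi> i) l)"
    define c where "c = y (Suc k) (Suc k)"
    have c: "c \<noteq> 0" using j \<pi> by (simp add: c_def y_def)
    obtain \<alpha> where \<alpha>: "\<exists>i\<le>k. \<alpha> i \<noteq> 0"
      "\<forall>l\<in>{1..k}. (\<Sum>i\<le>k. \<alpha> i * (y i l - y i (Suc k) / c * y (Suc k) l)) = 0"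
      using Suc.IH[of "\<lambda>i l. y i l - y i (Suc k) / c * y (Suc k) l"] by blast
    define t where "t = - (\<Sum>i\<le>k. \<alpha> i * y i (Suc k)) / c"
    define \<mu> where "\<mu> = \<alpha>(Suc k := t)"
    have eq: "(\<Sum>i\<le>Suc k. \<mu> i * y i l) = (\<Sum>i\<le>k. \<alpha> i * (y i l - y i (Suc k) / c * y (Suc k) l))" for l
      by (simp add: \<mu>_def t_def algebra_simps sum_subtractf sum_distrib_left sum_distrib_right
          sum_divide_distrib)
    have z: "(\<Sum>i\<le>Suc k. \<mu> i * y i l) = 0" if "l \<in> {1..Suc k}" for l
    proof (cases "l = Suc k")
      case True
      then show ?thesis using c unfolding eq by (simp add: c_def)
    next
      case False
      then show ?thesis unfolding eq using \<alpha>(2) that by auto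
    qed
    have "(\<Sum>i\<le>Suc k. \<mu> (\<pi> i) * x i l) = (\<Sum>i\<le>Suc k. \<mu> i * y i l)" for l
      using sum.reindex_bij_betw[OF \<pi>(3), of "\<lambda>i. \<mu> (\<pi> i) * x i l"] by (simp add: y_def \<pi>(2))
    then have "\<forall>l\<in>{1..Suc k}. (\<Sum>i\<le>Suc k. \<mu> (\<pi> i) * x i l) = 0" using z by simp
    moreover obtain i where "i \<le> k" "\<alpha> i \<noteq> 0" using \<alpha>(1) by blast
    then have "\<pi> i \<le> Suc k \<and> \<mu> (\<pi> (\<pi> i)) \<noteq> 0"
      using \<pi>(3) by (auto simp: \<mu>_def \<pi>(2) bij_betw_def)
    then have "\<exists>i\<le>Suc k. \<mu> (\<pi> i) \<noteq> 0" by blast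
    ultimately show ?thesis by (intro exI[of _ "\<lambda>i. \<mu> (\<pi> i)"]) blast
  qed
qed

lemma sum_image_cong:
  assumes "\<And>s t. s \<in> T \<Longrightarrow> t \<in> T \<Longrightarrow> f s = f t \<longleftrightarrow> g s = g t"
    and "\<And>t. t \<in> T \<Longrightarrow> u (f t) = v (g t)"
  shows "sum u (f ` T) = sum v (g ` T)"
proof -
  define h where "h = (\<lambda>x. g (inv_into T f x))"
  have h: "h (f t) = g t" if "t \<in> T" for t
    using assms(1)[of "inv_into T f (f t)" t] that f_inv_into_f[of "f t" f T] inv_into_into[of "f t" f T]
    by (simp add: h_def)
  have "bij_betw h (f ` T) (g ` T)"
    unfolding bij_betw_def using h assms(1) by (auto simp: inj_on_def image_iff)
  then have "sum v (g ` T) = (\<Sum>x\<in>f ` T. v (h x))" by (simp add: sum.reindex_bij_betw)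
  also have "\<dots> = sum u (f ` T)" using h assms(2) by (intro sum.cong) auto
  finally show ?thesis by simp
qed

text \<open>The map \<open>g t \<mapsto> f t\<close> has a section that is injective and does not hit \<open>g
t2\<close>.\<close>

lemma sum_image_less:
  fixes w :: "'b \<Rightarrow> real"
  assumes fin: "finite Y" and sub: "g ` T \<subseteq> Y" and pos: "\<And>y. w y \<ge> 0"
    and fg: "\<And>s t. s \<in> T \<Longrightarrow> t \<in> T \<Longrightarrow> g s = g t \<Longrightarrow> f s = f t"
    and le: "\<And>t. t \<in> T \<Longrightarrow> u (f t) \<le> w (g t)"
    and t: "t1 \<in> T" "t2 \<in> T" "f t1 = f t2" "g t1 \<noteq> g t2" "w (g t2) > 0"
  shows "sum u (f ` T) < sum w Y"
proof -
  define h where "h = (\<lambda>x. if x = f t1 then t1 else inv_into T f x)"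
  have h: "h x \<in> T" "f (h x) = x" if "x \<in> f ` T" for x
    using that t(1) by (auto simp: h_def inv_into_into f_inv_into_f)
  have inj: "inj_on (\<lambda>x. g (h x)) (f ` T)"
    by (rule inj_onI) (metis fg h)
  have fin': "finite ((\<lambda>x. g (h x)) ` f ` T)"
    using h sub by (intro finite_subset[OF _ fin]) auto
  have notin: "g t2 \<notin> (\<lambda>x. g (h x)) ` f ` T"
  proof
    assume "g t2 \<in> (\<lambda>x. g (h x)) ` f ` T"
    then obtain x where x: "x \<in> f ` T" "g t2 = g (h x)" by blast
    then have "f t2 = x" using fg[OF t(2) h(1)[OF x(1)]] h(2) by metis
    then have "h x = t1" using t(3) by (simp add: h_def)
    then show False using x t(4) by simp
  qed
  have "sum u (f ` T) \<le> (\<Sum>x\<in>f ` T. w (g (h x)))"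
    using le h by (intro sum_mono) metis
  also have "\<dots> = sum w ((\<lambda>x. g (h x)) ` f ` T)" by (simp add: sum.reindex[OF inj])
  also have "\<dots> < sum w (insert (g t2) ((\<lambda>x. g (h x)) ` f ` T))" using notin fin' t(5) by simp
  also have "\<dots> \<le> sum w Y" using h sub t pos by (intro sum_mono2[OF fin]) auto
  finally show ?thesis .
qed

definition disc_mass :: "int \<Rightarrow> real" where
  "disc_mass D = sum orbit_weight (disc_orbits D)"

lemma disc_orbits_rooted:
  assumes "\<And>f. cubic_disc f = D \<Longrightarrow> has_root p f"
  shows "disc_orbits D = (\<lambda>t. form_orbit (rooted_form p t)) ` {t. cubic_disc (rooted_form p t) = D}"
proof (intro subset_antisym subsetI)
  fix X assume "X \<in> disc_orbits D"
  then obtain f where f: "X = form_orbit f" "cubic_disc f = D" by (auto simp: disc_orbits_def)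
  then obtain t where t: "form_equiv f (rooted_form p t)" using assms by (auto simp: has_root_def)
  then have "X = form_orbit (rooted_form p t)" using f by (simp add: form_orbit_eq_iff)
  then show "X \<in> (\<lambda>t. form_orbit (rooted_form p t)) ` {t. cubic_disc (rooted_form p t) = D}"
    using form_equiv_disc[OF t] f by blast
qed (auto simp: disc_orbits_def)

lemma disc_orbits_subring_subset:
  "(\<lambda>t. form_orbit (subring_form p t)) ` {t. cubic_disc (rooted_form p t) = D} \<subseteq> disc_orbits (p^2 * D)"
  by (auto simp: disc_orbits_def disc_subring_form)

lemma disc_mass_nonresidue:
  assumes p: "prime p" "\<not> p dvd 6" and nr: "nonresidue p D" and z: "p dvd z^2 + z + 1"
  shows "disc_mass (p^2 * D) = disc_mass D"
proof -
  define T where "T = {t. cubic_disc (rooted_form p t) = D}"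
  have p0: "p \<noteq> 0" using p by auto
  have low: "disc_orbits D = (\<lambda>t. form_orbit (rooted_form p t)) ` T"
    unfolding T_def by (rule disc_orbits_rooted) (use nonresidue_has_root[OF p(1)] nr in blast)
  have high: "disc_orbits (p^2 * D) = (\<lambda>t. form_orbit (subring_form p t)) ` T"
  proof (rule antisym[OF subsetI])
    fix X assume "X \<in> disc_orbits (p^2 * D)"
    then obtain F where F: "X = form_orbit F" "cubic_disc F = p^2 * D" by (auto simp: disc_orbits_def)
    then obtain t where t: "form_equiv F (subring_form p t)" using subring_form_if_disc_square_mult[OF p nr z] by blast
    then have "p^2 * cubic_disc (rooted_form p t) = p^2 * D"
      using form_equiv_disc[OF t] F disc_subring_form by metis
    then have "t \<in> T" using p0 by (simp add: T_def)
    then show "X \<in> (\<lambda>t. form_orbit (subring_form p t)) ` T"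
      using t F by (auto simp: form_orbit_eq_iff)
  qed (use disc_orbits_subring_subset in \<open>simp add: T_def\<close>)
  have "sum orbit_weight ((\<lambda>t. form_orbit (subring_form p t)) ` T) = sum orbit_weight ((\<lambda>t. form_orbit (rooted_form p t)) ` T)"
  proof (rule sum_image_cong)
    fix s t assume st: "s \<in> T" "t \<in> T"
    have nr': "nonresidue p (cubic_disc (rooted_form p s))" using nr st by (simp add: T_def)
    have "form_equiv (rooted_form p s) (rooted_form p t)" if "form_equiv (subring_form p s) (subring_form p t)"
      using rooted_equiv_if_subring_equiv[OF p(1) nonresidue_not_dvd[OF nr'] that]
      by (metis form_equiv_mat2 mult.assoc)
    then show "form_orbit (subring_form p s) = form_orbit (subring_form p t) \<longleftrightarrow>
        form_orbit (rooted_form p s) = form_orbit (rooted_form p t)"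
      using subring_equiv_if_rooted_equiv[OF p(1) nr'] unfolding form_orbit_eq_iff by blast
    show "orbit_weight (form_orbit (subring_form p t)) = orbit_weight (form_orbit (rooted_form p t))"
      using stab_card_subring_form_nonresidue[OF p(1)] nr st by (simp add: orbit_weight T_def)
  qed
  then show ?thesis by (simp add: disc_mass_def low high)
qed

lemma square_if_square_mult:
  fixes x y D :: int
  assumes "x^2 = D * y^2" "y \<noteq> 0"
  obtains z where "D = z^2"
proof -
  have "y^2 dvd x^2" using assms by simp
  then have "y dvd x" by simp
  then obtain z where "x = y * z" by (elim dvdE)
  then have "y^2 * z^2 = y^2 * D" using assms by (simp add: power_mult_distrib mult.commute)
  then have "D = z^2" using assms(2) by simp
  then show thesis by (rule that)
qed

text \<open>As \<open>1 - 4 d\<close> is not a square, \<open>(1 : 0)\<close> is the only rational root of \<open>v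
(u\<^sup>2 + u v + d v\<^sup>2)\<close>, so a stabilizing matrix has upper right entry zero.\<close>

lemma stabilizer_reducible:
  assumes "\<And>z. 1 - 4 * d \<noteq> z^2"
  shows "stabilizer SL2Z cubic_act (Cubic 0 1 1 d) = {mat 1}"
proof (intro subset_antisym subsetI)
  fix g assume g: "g \<in> stabilizer SL2Z cubic_act (Cubic 0 1 1 d)"
  obtain p q r s where gm: "g = mat2 p q r s" using mat2_eta by blast
  have det: "p * s - q * r = 1" using g gm by (simp add: mem_stabilizer)
  have eq: "p^2 * q + p * q^2 + d * q^3 = 0" "p^2 * s + 2 * p * q * r + (2 * p * q * s + q^2 * r) + 3 * d * q^2 * s = 1"
    "2 * p * r * s + q * r^2 + (p * s^2 + 2 * q * r * s) + 3 * d * q * s^2 = 1"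
    using g unfolding gm mem_stabilizer cubic_act_mat2[OF det] by simp_all
  have q: "q = 0"
  proof (rule ccontr)
    assume "q \<noteq> 0"
    moreover have "q * (p^2 + p * q + d * q^2) = 0"
      using eq(1) by (simp add: algebra_simps power2_eq_square power3_eq_cube)
    ultimately have "p^2 + p * q + d * q^2 = 0" by simp
    then have "4 * (p^2 + p * q + d * q^2) = 0" by simp
    then have "(2 * p + q)^2 = (1 - 4 * d) * q^2" by (simp add: algebra_simps power2_eq_square)
    then show False using square_if_square_mult \<open>q \<noteq> 0\<close> assms by metis
  qed
  have ps: "p * s = 1" using det q by simp
  moreover have "p * (p * s) = 1" using eq(2) q by (simp add: power2_eq_square)
  ultimately have p: "p = 1" by simp
  then have s: "s = 1" using ps by simp
  then have "r = 0" using eq(3) q p by simp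
  then show "g \<in> {mat 1}" using p q s by (simp add: gm mat_1_eq_mat2)
qed (simp add: mem_stabilizer cubic_act_one del: cubic_act.simps)

lemma orbit_weight_nonneg: "orbit_weight X \<ge> 0"
  by (simp add: orbit_weight_def)

text \<open>The stabilizer of \<open>subring_form p t\<close> is isomorphic to a subgroup of that of \<open>rooted_form
p t\<close>. An infinite stabilizer has cardinality 0 and the orbit then has weight \<open>1 / 0 =
0\<close>, which is consistent with the inequality.\<close>

lemma orbit_weight_rooted_le_subring:
  assumes p: "prime p" and D: "\<not> p dvd cubic_disc (rooted_form p t)"
  shows "orbit_weight (form_orbit (rooted_form p t)) \<le> orbit_weight (form_orbit (subring_form p t))"
    and "stab_card (rooted_form p t) \<noteq> 0 \<Longrightarrow> orbit_weight (form_orbit (subring_form p t)) > 0"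
proof -
  define S where "S = stabilizer SL2Z cubic_act (rooted_form p t)"
  define S' where "S' = {g \<in> S. p dvd g$1$2}"
  have c: "stab_card (rooted_form p t) = card S" "stab_card (subring_form p t) = card S'"
    using stab_card_subring_form[OF assms] by (simp_all add: S_def S'_def stab_card_def)
  have "(mat 1 :: int^2^2) $ 1 $ 2 = 0" by (simp add: mat_def)
  then have "mat 1 \<in> S'" by (simp add: S'_def S_def mem_stabilizer cubic_act_one)
  then have "card S' > 0 \<and> card S' \<le> card S" if "card S \<noteq> 0"
  proof -
    have fin: "finite S" using that card_ge_0_finite by blast
    have sub: "S' \<subseteq> S" by (auto simp: S'_def)
    have "finite S'" using fin sub finite_subset by blast
    then show ?thesis using \<open>mat 1 \<in> S'\<close> card_mono[OF fin sub] by (auto simp: card_gt_0_iff)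
  qed
  then show "orbit_weight (form_orbit (rooted_form p t)) \<le> orbit_weight (form_orbit (subring_form p t))"
    "stab_card (rooted_form p t) \<noteq> 0 \<Longrightarrow> orbit_weight (form_orbit (subring_form p t)) > 0"
    unfolding orbit_weight c by (cases "card S = 0"; auto intro!: divide_left_mono)+
qed

text \<open>Sending the class of \<open>subring_form p t\<close> to that of \<open>rooted_form p t\<close> is onto the
classes of discriminant \<open>D\<close> and does not decrease weights from target to source. The form
\<open>f = u\<^sup>2v + uv\<^sup>2 + dv\<^sup>3\<close> has trivial stabilizer and, besides \<open>(1 :
0)\<close>, a further root \<open>(r : 1)\<close> modulo \<open>p\<close>, since \<open>D = 1 - 4 d\<close>
is a square there. So its class has at least two preimages, and the inequality is strict.\<close>

lemma disc_mass_split: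
  assumes p: "prime p" "\<not> p dvd 2" and D: "\<not> p dvd D" "D = 1 - 4 * d" "\<And>z. D \<noteq> z^2"
    and root: "\<And>f. cubic_disc f = D \<Longrightarrow> has_root p f" and x: "p dvd x^2 - D"
  shows "disc_mass D < disc_mass (p^2 * D)"
proof -
  define T where "T = {t. cubic_disc (rooted_form p t) = D}"
  have p0: "p \<noteq> 0" and p1: "p > 1" using p by (auto simp: prime_gt_1_int)
  have D0: "D \<noteq> 0" using D(1) by auto
  have low: "disc_orbits D = (\<lambda>t. form_orbit (rooted_form p t)) ` T"
    unfolding T_def by (rule disc_orbits_rooted) (rule root)
  define f where "f = Cubic 0 1 1 d"
  have fD: "cubic_disc f = D" by (simp add: f_def D)
  have stabf: "stabilizer SL2Z cubic_act f = {mat 1}"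
    unfolding f_def using D by (intro stabilizer_reducible) auto
  have t1: "rooted_form p f = f" "f \<in> T" using fD by (simp_all add: f_def T_def)
  obtain y k where y: "2 * y = 1 + p * k" using mod_inverse[OF p] by metis
  \<comment> \<open>the root (x - 1) / 2 of X^2 + X + d modulo p, where x^2 = D = 1 - 4 d\<close>
  define r where "r = (x - 1) * y"
  have "p dvd r^2 + r + d"
  proof -
    have r2: "2 * r = (x - 1) + p * (k * (x - 1))"
      using arg_cong[OF y, of "\<lambda>w. (x - 1) * w"] by (simp add: r_def algebra_simps)
    obtain m where m: "x^2 - D = p * m" using x by (elim dvdE)
    have "4 * (r^2 + r + d) = (2 * r + 1)^2 - D" by (simp add: D(2) algebra_simps power2_eq_square)
    also have "\<dots> = (x + p * (k * (x - 1)))^2 - D" unfolding r2 by simp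
    also have "\<dots> = p * (m + 2 * x * (k * (x - 1)) + p * (k * (x - 1))^2)"
      using m by algebra
    finally have "p dvd 2 * (2 * (r^2 + r + d))" by simp
    then show ?thesis using p by (simp only: prime_dvd_mult_iff) simp
  qed
  then obtain a where a: "r^2 + r + d = p * a" by (elim dvdE)
  define t2 where "t2 = Cubic a (- 2 * r - 1) 1 0"
  have det: "r * 0 - 1 * (-1) = (1 :: int)" by simp
  have act: "cubic_act (mat2 r 1 (-1) 0) f = rooted_form p t2"
    unfolding f_def cubic_act_mat2[OF det] t2_def using a by simp
  have eq: "form_equiv f (rooted_form p t2)" using form_equiv_mat2[OF det, of f] act by simp
  have t2: "t2 \<in> T" using form_equiv_disc[OF eq] fD by (simp add: T_def)
  have ne: "form_orbit (subring_form p f) \<noteq> form_orbit (subring_form p t2)"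
  proof
    assume "form_orbit (subring_form p f) = form_orbit (subring_form p t2)"
    then have "form_equiv (subring_form p f) (subring_form p t2)" by (simp add: form_orbit_eq_iff)
    then obtain P Q R S where PQ: "P * S - p * Q * R = 1"
      "cubic_act (mat2 P (p * Q) R S) (rooted_form p f) = rooted_form p t2"
      using rooted_equiv_if_subring_equiv[OF p(1), of f t2] D(1) fD t1 by auto
    \<comment> \<open>g and g' both carry f to the same form, but p divides only the upper right entry of g',
      and the stabilizer of f is trivial\<close>
    define g where "g = mat2 r 1 (-1) 0"
    define g' where "g' = mat2 P (p * Q) R S"
    have g: "det g = 1" "det g' = 1" using PQ by (simp_all add: g_def g'_def)
    obtain h where h: "det h = 1" "h ** g = mat 1" "g ** h = mat 1" using SL2Z_inverse[OF g(1)] .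
    have "cubic_act (h ** g') f = cubic_act h (cubic_act g f)"
      using PQ act t1 by (simp add: cubic_act_mult g_def g'_def)
    also have "\<dots> = f" by (rule cubic_act_cancel[OF h(2)])
    finally have "h ** g' \<in> stabilizer SL2Z cubic_act f" using h g by (simp add: mem_stabilizer det_mul)
    then have "h ** g' = mat 1" using stabf by simp
    then have "g ** (h ** g') = g" by simp
    then have "g' = g" using h(3) by (simp add: matrix_mul_assoc)
    then have "p * Q = 1" by (simp add: g_def g'_def mat2_eq_iff)
    then show False using p1 by (metis dvd_triv_left not_prime_unit p(1))
  qed
  have "sum orbit_weight ((\<lambda>t. form_orbit (rooted_form p t)) ` T) < sum orbit_weight (disc_orbits (p^2 * D))"
  proof (rule sum_image_less[where g = "\<lambda>t. form_orbit (subring_form p t)" and ?t1.0 = f and ?t2.0 = t2])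
    show "finite (disc_orbits (p^2 * D))" using D0 p0 by (intro finite_disc_orbits) simp
    show "(\<lambda>t. form_orbit (subring_form p t)) ` T \<subseteq> disc_orbits (p^2 * D)"
      unfolding T_def by (rule disc_orbits_subring_subset)
    show "form_orbit (rooted_form p s) = form_orbit (rooted_form p t)"
      if "s \<in> T" "t \<in> T" "form_orbit (subring_form p s) = form_orbit (subring_form p t)" for s t
    proof -
      have "form_equiv (subring_form p s) (subring_form p t)" using that by (simp add: form_orbit_eq_iff)
      moreover have "\<not> p dvd cubic_disc (rooted_form p s)" using that D by (simp add: T_def)
      ultimately obtain P Q R S where "P * S - p * Q * R = 1"
        "cubic_act (mat2 P (p * Q) R S) (rooted_form p s) = rooted_form p t"
        using rooted_equiv_if_subring_equiv[OF p(1)] by blast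
      then show ?thesis using form_equiv_mat2[of P S "p * Q" R "rooted_form p s"] by (simp add: form_orbit_eq_iff)
    qed
    show "orbit_weight (form_orbit (rooted_form p t)) \<le> orbit_weight (form_orbit (subring_form p t))" if "t \<in> T" for t
      using orbit_weight_rooted_le_subring(1)[OF p(1)] that D by (simp add: T_def)
    have "stab_card (rooted_form p t2) = 1" using stab_card_equiv[OF eq] stabf by (simp add: stab_card_def)
    then show "orbit_weight (form_orbit (subring_form p t2)) > 0"
      using orbit_weight_rooted_le_subring(2)[OF p(1), of t2] t2 D by (simp add: T_def)
    show "form_orbit (rooted_form p f) = form_orbit (rooted_form p t2)" using eq t1 by (simp add: form_orbit_eq_iff)
  qed (use t1 t2 ne orbit_weight_nonneg in auto)
  then show ?thesis by (simp add: disc_mass_def low)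
qed

text \<open>The polynomials are the dehomogenised representatives of the classes of discriminant \<open>D\<close>
together with \<open>X\<^sup>2 + X + 1\<close> and \<open>X\<^sup>2 - D\<close>. Representatives with
leading coefficient zero have the root \<open>(1 : 0)\<close> modulo every prime.\<close>

section \<open>Choice of primes and discriminants\<close>

lemma exists_splitting_prime:
  assumes "D \<noteq> 0" "N \<noteq> 0"
  obtains p z x where "prime (p :: nat)" "\<not> int p dvd N" "\<And>f. cubic_disc f = D \<Longrightarrow> has_root (int p) f"
    "int p dvd z^2 + z + 1" "int p dvd x^2 - D"
proof -
  define rep where "rep = (\<lambda>X :: cubic set. SOME f. f \<in> X)"
  define pol where "pol = (\<lambda>f. case f of Cubic a b c d \<Rightarrow> [:d, c, b, a:])"
  define S where "S = {q \<in> (\<lambda>X. pol (rep X)) ` disc_orbits D. degree q = 3} \<union> {[:1, 1, 1:], [:- D, 0, 1:]}"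
  have "finite S" using finite_disc_orbits[OF assms(1)] by (simp add: S_def)
  moreover have "degree q > 0" if "q \<in> S" for q using that by (auto simp: S_def)
  ultimately obtain p where p: "prime p" "\<not> int p dvd N" and S: "\<And>q. q \<in> S \<Longrightarrow> \<exists>x. int p dvd poly q x"
    using common_prime_with_roots[OF _ _ assms(2)] by metis
  have "has_root (int p) f" if f: "cubic_disc f = D" for f
  proof -
    have X: "form_orbit f \<in> disc_orbits D" using f by (auto simp: disc_orbits_def)
    have "rep (form_orbit f) \<in> form_orbit f"
      unfolding rep_def by (rule someI[of _ f]) (simp add: form_orbit_eq form_equiv_refl)
    then have eq: "form_equiv f (rep (form_orbit f))" by (simp add: form_orbit_eq)
    obtain a b c d where r: "rep (form_orbit f) = Cubic a b c d" by (cases "rep (form_orbit f)")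
    have "has_root (int p) (Cubic a b c d)"
    proof (cases "a = 0")
      case True
      then show ?thesis by (intro has_root_infinity) simp
    next
      case False
      then have "[:d, c, b, a:] \<in> S"
        using X r by (auto simp: S_def pol_def intro!: image_eqI[of _ _ "form_orbit f"])
      then obtain k where "int p dvd poly [:d, c, b, a:] k" using S by blast
      also have "poly [:d, c, b, a:] k = a * k^3 + b * k^2 + c * k + d"
        by (simp add: algebra_simps power2_eq_square power3_eq_cube)
      finally show ?thesis by (rule has_root_affine)
    qed
    then show ?thesis using has_root_equiv eq r by metis
  qed
  moreover have "[:1, 1, 1:] \<in> S" "[:- D, 0, 1:] \<in> S" by (simp_all add: S_def)
  then obtain z x where "int p dvd poly [:1, 1, 1:] z" "int p dvd poly [:- D, 0, 1:] x" using S by blast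
  then have "int p dvd z^2 + z + 1" "int p dvd x^2 - D"
    by (simp_all add: algebra_simps power2_eq_square)
  ultimately show thesis using that p by blast
qed

text \<open>Squaring is not injective modulo an odd prime, hence not surjective.\<close>

lemma exists_nonresidue:
  assumes "prime p" "\<not> p dvd 2"
  shows "\<exists>D\<ge>0. nonresidue p D"
proof -
  have p: "p > 2" using assms prime_ge_2_int[of p] by (cases "p = 2") auto
  define sq where "sq = (\<lambda>x :: int. x^2 mod p)"
  have "sq 1 = sq (p - 1)"
  proof -
    have "(p - 1)^2 = 1 + p * (p - 2)" by (simp add: algebra_simps power2_eq_square)
    then show ?thesis unfolding sq_def by simp
  qed
  then have ninj: "\<not> inj_on sq {0..<p}" using p inj_onD[of sq "{0..<p}" 1 "p - 1"] by auto
  have sub: "sq ` {0..<p} \<subseteq> {0..<p}" using p by (auto simp: sq_def)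
  have "sq ` {0..<p} \<noteq> {0..<p}"
    using ninj eq_card_imp_inj_on[of "{0..<p}" sq] by auto
  then obtain D where D: "D \<in> {0..<p}" "D \<notin> sq ` {0..<p}" using sub by blast
  have "\<not> p dvd x^2 - D" for x
  proof
    assume "p dvd x^2 - D"
    then have "x^2 mod p = D" using D(1) by (metis atLeastLessThan_iff mod_eq_dvd_iff mod_pos_pos_trivial)
    then have "sq (x mod p) = D" by (simp add: sq_def power_mod)
    moreover have "x mod p \<in> {0..<p}" using p by simp
    ultimately show False using D(2) by blast
  qed
  then show ?thesis using D(1) by (auto simp: nonresidue_def)
qed

lemma nonresidue_cong:
  assumes "nonresidue p D" "p dvd D' - D"
  shows "nonresidue p D'"
  unfolding nonresidue_def
proof (intro allI notI)
  fix x assume "p dvd x^2 - D'"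
  then have "p dvd (x^2 - D') + (D' - D)" using assms(2) by (rule dvd_add)
  then show False using assms(1) by (simp add: nonresidue_def)
qed

text \<open>A discriminant congruent to 5 modulo 8 is congruent to 1 modulo 4 and is not a square. The nonresidue
conditions are added one prime at a time by the Chinese remainder theorem, and the sign is fixed by adding a
large multiple of the modulus.\<close>

lemma exists_discriminant:
  assumes \<epsilon>: "\<epsilon> = 1 \<or> \<epsilon> = (-1 :: int)" and P: "finite P" "\<And>p. p \<in> P \<Longrightarrow> prime (p :: nat) \<and> \<not> int p dvd 2"
  obtains n d :: int where "n > 0" "\<epsilon> * n = 1 - 4 * d" "\<And>z. \<epsilon> * n \<noteq> z^2"
    "\<And>p. p \<in> P \<Longrightarrow> nonresidue (int p) (\<epsilon> * n)"
proof -
  have "\<exists>x. x mod 8 = 5 \<and> (\<forall>p\<in>P. nonresidue (int p) x)"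
    using P
  proof (induction P rule: finite_induct)
    case empty
    show ?case by (intro exI[of _ 5]) auto
  next
    case (insert p P)
    then obtain x where x: "x mod 8 = 5" "\<forall>p\<in>P. nonresidue (int p) x" by auto
    obtain u where u: "nonresidue (int p) u" using exists_nonresidue[of "int p"] insert.prems[of p] by auto
    define m where "m = 8 * (\<Prod>p\<in>P. int p)"
    have m: "\<not> int p dvd m"
    proof
      assume "int p dvd m"
      then have "int p dvd 2 * (2 * (2 * (\<Prod>p\<in>P. int p)))" by (simp add: m_def mult.assoc[symmetric])
      moreover have "prime (int p)" "\<not> int p dvd 2" using insert.prems[of p] by auto
      ultimately have "int p dvd (\<Prod>p\<in>P. int p)" by (metis prime_dvd_mult_iff)
      then obtain q where "q \<in> P" "int p dvd int q"
        using insert.prems[of p] insert.hyps(1) by (auto simp: prime_dvd_prod_iff)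
      then show False using insert.prems[of p] insert.prems[of q] insert.hyps(2)
        by (auto dest: primes_dvd_imp_eq)
    qed
    have "prime (int p)" using insert.prems[of p] by simp
    then obtain m' k where mk: "m * m' = 1 + int p * k" using mod_inverse[OF _ m] by blast
    define y where "y = x + m * (m' * (u - x))"
    have "y - u = (m * m' - 1) * (u - x)" by (simp add: y_def algebra_simps)
    then have "int p dvd y - u" using mk by simp
    then have "nonresidue (int p) y" using u nonresidue_cong by blast
    moreover have "nonresidue (int q) y" if q: "q \<in> P" for q
    proof -
      have "int q dvd (\<Prod>p\<in>P. int p)" using q insert.hyps(1) by (rule dvd_prodI[rotated])
      then have "int q dvd y - x" by (simp add: y_def m_def)
      then show ?thesis using x(2) q nonresidue_cong by blast
    qed
    moreover have "y mod 8 = 5"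
    proof -
      have "y = x + 8 * ((\<Prod>p\<in>P. int p) * (m' * (u - x)))" by (simp add: y_def m_def)
      then show ?thesis using x(1) by (simp only: mod_mult_self2)
    qed
    ultimately show ?case by (intro exI[of _ y]) auto
  qed
  then obtain x where x: "x mod 8 = 5" "\<forall>p\<in>P. nonresidue (int p) x" by blast
  define m where "m = 8 * (\<Prod>p\<in>P. int p)"
  have m: "m > 0"
  proof -
    have "(\<Prod>p\<in>P. int p) > 0" using P(2) prime_gt_0_nat by (intro prod_pos) simp
    then show ?thesis by (simp add: m_def)
  qed
  define n where "n = \<epsilon> * x + m * (\<bar>x\<bar> + 1)"
  have "\<bar>x\<bar> < 1 * (\<bar>x\<bar> + 1)" by simp
  also have "\<dots> \<le> m * (\<bar>x\<bar> + 1)" using m by (intro mult_right_mono) auto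
  finally have "\<bar>x\<bar> < m * (\<bar>x\<bar> + 1)" .
  moreover have "- \<bar>x\<bar> \<le> \<epsilon> * x" using \<epsilon> by auto
  ultimately have "- \<bar>x\<bar> + \<bar>x\<bar> < \<epsilon> * x + m * (\<bar>x\<bar> + 1)" by (rule add_le_less_mono[rotated])
  then have n: "n > 0" by (simp add: n_def)
  have en: "\<epsilon> * n = x + m * (\<epsilon> * (\<bar>x\<bar> + 1))" using \<epsilon> by (auto simp: n_def algebra_simps)
  have mod: "(\<epsilon> * n) mod 8 = 5"
  proof -
    have "\<epsilon> * n = x + 8 * ((\<Prod>p\<in>P. int p) * (\<epsilon> * (\<bar>x\<bar> + 1)))" by (simp add: en m_def)
    then show ?thesis using x(1) by (simp only: mod_mult_self2)
  qed
  have "\<epsilon> * n = 1 - 4 * (- (2 * ((\<epsilon> * n) div 8) + 1))" using mod by presburger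
  moreover have "\<epsilon> * n \<noteq> z^2" for z
  proof
    assume "\<epsilon> * n = z^2"
    then have "z^2 mod 8 = 5" using mod by simp
    moreover have "z^2 mod 8 = (z mod 8)^2 mod 8" by (simp add: power_mod)
    moreover have "z mod 8 \<in> {0, 1, 2, 3, 4, 5, 6, 7}" by (simp, presburger)
    ultimately show False by auto
  qed
  moreover have "nonresidue (int p) (\<epsilon> * n)" if "p \<in> P" for p
  proof -
    have "int p dvd (\<Prod>p\<in>P. int p)" using that P(1) by (rule dvd_prodI[rotated])
    then have "int p dvd \<epsilon> * n - x" by (simp add: en m_def)
    then show ?thesis using x(2) that nonresidue_cong by blast
  qed
  ultimately show thesis using that n by blast
qed

text \<open>The last condition says that \<open>-3\<close> is a square modulo \<open>p\<close>.\<close>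

definition good_prime :: "nat \<Rightarrow> bool" where
  "good_prime p \<longleftrightarrow> prime p \<and> \<not> int p dvd 6 \<and> (\<exists>z. int p dvd z^2 + z + 1)"

text \<open>With \<open>a(n) = disc_mass (\<epsilon> n)\<close>, the matrix \<open>a(p\<^sub>i\<^sup>2 n\<^sub>j) -
a(n\<^sub>j)\<close> of size \<open>k\<close> vanishes above the diagonal and nowhere on it.\<close>

definition triangular_family :: "int \<Rightarrow> nat \<Rightarrow> (nat \<Rightarrow> nat) \<Rightarrow> (nat \<Rightarrow> nat) \<Rightarrow> bool" where
  "triangular_family \<epsilon> k p n \<longleftrightarrow>
     (\<forall>i<k. good_prime (p i) \<and> n i > 0) \<and>
     (\<forall>i<k. \<forall>j<k. \<not> p i dvd n j) \<and>
     (\<forall>j<k. \<forall>i<j. disc_mass ((int (p i))^2 * (\<epsilon> * int (n j))) = disc_mass (\<epsilon> * int (n j))) \<and>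
     (\<forall>i<k. disc_mass ((int (p i))^2 * (\<epsilon> * int (n i))) \<noteq> disc_mass (\<epsilon> * int (n i)))"

lemma triangular_familyD:
  assumes "triangular_family \<epsilon> k p n"
  shows "i < k \<Longrightarrow> good_prime (p i)" "i < k \<Longrightarrow> n i > 0" "i < k \<Longrightarrow> j < k \<Longrightarrow> \<not> p i dvd n j"
    "j < k \<Longrightarrow> i < j \<Longrightarrow> disc_mass ((int (p i))^2 * (\<epsilon> * int (n j))) = disc_mass (\<epsilon> * int (n j))"
    "i < k \<Longrightarrow> disc_mass ((int (p i))^2 * (\<epsilon> * int (n i))) \<noteq> disc_mass (\<epsilon> * int (n i))"
  using assms unfolding triangular_family_def by blast+

lemma triangular_family_exists:
  assumes \<epsilon>: "\<epsilon> = 1 \<or> \<epsilon> = (-1 :: int)"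
  shows "\<exists>p n. triangular_family \<epsilon> k p n"
proof (induction k)
  case 0
  show ?case by (simp add: triangular_family_def)
next
  case (Suc k)
  then obtain p n where "triangular_family \<epsilon> k p n" by blast
  note IH = triangular_familyD[OF this]
  have odd: "\<not> int q dvd 2" if "\<not> int q dvd 6" for q using that dvd_trans[of "int q" 2 6] by auto
  have "prime q \<and> \<not> int q dvd 2" if "q \<in> p ` {..<k}" for q
    using that IH(1) odd by (auto simp: good_prime_def)
  then obtain N d :: int where N: "N > 0" "\<epsilon> * N = 1 - 4 * d" "\<And>z. \<epsilon> * N \<noteq> z^2"
    "\<And>q. q \<in> p ` {..<k} \<Longrightarrow> nonresidue (int q) (\<epsilon> * N)"
    using exists_discriminant[OF \<epsilon>, of "p ` {..<k}"] by blast
  define m where "m = nat N"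
  have m: "int m = N" "m > 0" using N(1) by (simp_all add: m_def)
  have D0: "\<epsilon> * N \<noteq> 0" using \<epsilon> N(1) by auto
  have "6 * (N * (\<Prod>i<k. int (n i))) \<noteq> 0" using N(1) IH(2) by simp
  then obtain q z x where q: "prime q" "\<not> int q dvd 6 * (N * (\<Prod>i<k. int (n i)))"
    "\<And>f. cubic_disc f = \<epsilon> * N \<Longrightarrow> has_root (int q) f" "int q dvd z^2 + z + 1" "int q dvd x^2 - \<epsilon> * N"
    using exists_splitting_prime[OF D0] by metis
  have q6: "\<not> int q dvd 6" and qN: "\<not> int q dvd N" and qn: "\<not> int q dvd (\<Prod>i<k. int (n i))"
    using q(2) by auto
  have gq: "good_prime q" using q q6 by (auto simp: good_prime_def)
  have less: "disc_mass (\<epsilon> * N) < disc_mass ((int q)^2 * (\<epsilon> * N))"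
  proof (rule disc_mass_split[OF _ odd[OF q6] _ N(2,3)])
    show "\<not> int q dvd \<epsilon> * N" using qN \<epsilon> by auto
  qed (use q in auto)
  have nr: "disc_mass ((int (p i))^2 * (\<epsilon> * N)) = disc_mass (\<epsilon> * N)" "\<not> p i dvd m" if i: "i < k" for i
  proof -
    have nri: "nonresidue (int (p i)) (\<epsilon> * N)" using N(4) i by blast
    then show "disc_mass ((int (p i))^2 * (\<epsilon> * N)) = disc_mass (\<epsilon> * N)"
      using IH(1)[OF i] disc_mass_nonresidue[of "int (p i)" "\<epsilon> * N"] by (auto simp: good_prime_def)
    have "\<not> int (p i) dvd \<epsilon> * N" by (rule nonresidue_not_dvd[OF nri])
    then show "\<not> p i dvd m" using m(1) by (metis dvd_mult int_dvd_int_iff)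
  qed
  have qni: "\<not> q dvd n i" if "i < k" for i
  proof
    assume "q dvd n i"
    then have "int q dvd int (n i)" by simp
    also have "int (n i) dvd (\<Prod>i<k. int (n i))" using that by (intro dvd_prodI) auto
    finally show False using qn by simp
  qed
  have qm: "\<not> q dvd m" using qN m(1) by (metis int_dvd_int_iff)
  have "triangular_family \<epsilon> (Suc k) (p(k := q)) (n(k := m))"
    unfolding triangular_family_def
    using IH gq m less nr qni qm by (auto simp: less_Suc_eq)
  then show ?case by blast
qed

theorem theorem1p1:
  fixes \<epsilon> :: int
  assumes "\<epsilon> = 1 \<or> \<epsilon> = -1"
  shows "\<not> (\<exists>(k::nat) (c :: nat \<Rightarrow> real) (b :: nat \<Rightarrow> nat \<Rightarrow> complex).
            k \<ge> 1 \<and> (\<forall>i\<in>{1..k}. multiplicative_fun (b i)) \<and>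
            (\<forall>n\<ge>1. complex_of_real (shintani_coeff \<epsilon> n)
                     = (\<Sum>i = 1..k. complex_of_real (c i) * b i n)))"
proof
  assume "\<exists>(k::nat) (c :: nat \<Rightarrow> real) (b :: nat \<Rightarrow> nat \<Rightarrow> complex).
            k \<ge> 1 \<and> (\<forall>i\<in>{1..k}. multiplicative_fun (b i)) \<and>
            (\<forall>n\<ge>1. complex_of_real (shintani_coeff \<epsilon> n)
                     = (\<Sum>i = 1..k. complex_of_real (c i) * b i n))"
  then obtain k :: nat and c :: "nat \<Rightarrow> real" and b :: "nat \<Rightarrow> nat \<Rightarrow> complex"
    where mult: "\<And>l. l \<in> {1..k} \<Longrightarrow> multiplicative_fun (b l)"
      and rep: "\<And>n. n \<ge> 1 \<Longrightarrow> complex_of_real (shintani_coeff \<epsilon> n)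
                     = (\<Sum>l = 1..k. complex_of_real (c l) * b l n)" by blast
  obtain p n where "triangular_family \<epsilon> (Suc k) p n"
    using triangular_family_exists[OF assms] by blast
  note pn = triangular_familyD[OF this, unfolded less_Suc_eq_le]
  define M where "M = (\<lambda>i j. complex_of_real
    (disc_mass ((int (p i))^2 * (\<epsilon> * int (n j))) - disc_mass (\<epsilon> * int (n j))))"
  define x where "x = (\<lambda>i l. complex_of_real (c l) * (b l ((p i)^2) - 1))"
  have M: "M i j = (\<Sum>l = 1..k. x i l * b l (n j))" if ij: "i \<le> k" "j \<le> k" for i j
  proof -
    have pi: "prime (p i)" using pn(1)[OF ij(1)] by (simp add: good_prime_def)
    have cop: "coprime ((p i)^2) (n j)"
      using pi pn(3)[OF ij] by (simp add: prime_imp_coprime)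
    have "M i j = complex_of_real (shintani_coeff \<epsilon> ((p i)^2 * n j)) - complex_of_real (shintani_coeff \<epsilon> (n j))"
      by (simp add: M_def shintani_coeff_eq disc_mass_def mult.left_commute)
    also have "\<dots> = (\<Sum>l = 1..k. complex_of_real (c l) * b l ((p i)^2 * n j))
        - (\<Sum>l = 1..k. complex_of_real (c l) * b l (n j))"
      using pn(2)[OF ij(2)] prime_gt_0_nat[OF pi] by (simp add: rep Suc_le_eq)
    also have "\<dots> = (\<Sum>l = 1..k. x i l * b l (n j))"
      unfolding sum_subtractf[symmetric]
    proof (rule sum.cong[OF refl])
      fix l assume "l \<in> {1..k}"
      then have "b l ((p i)^2 * n j) = b l ((p i)^2) * b l (n j)"
        using mult cop pn(2)[OF ij(2)] prime_gt_0_nat[OF pi] by (auto simp: multiplicative_fun_def)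
      then show "complex_of_real (c l) * b l ((p i)^2 * n j) - complex_of_real (c l) * b l (n j)
          = x i l * b l (n j)" by (simp add: x_def algebra_simps)
    qed
    finally show ?thesis .
  qed
  obtain \<alpha> where \<alpha>: "\<exists>i\<le>k. \<alpha> i \<noteq> 0" "\<forall>l\<in>{1..k}. (\<Sum>i\<le>k. \<alpha> i * x i l) = 0"
    using homogeneous_system_solution[of k x] by blast
  have rel: "(\<Sum>i\<le>k. \<alpha> i * M i j) = 0" if j: "j \<le> k" for j
  proof -
    have "(\<Sum>i\<le>k. \<alpha> i * M i j) = (\<Sum>i\<le>k. \<Sum>l = 1..k. \<alpha> i * x i l * b l (n j))"
      using M j by (simp add: sum_distrib_left mult.assoc)
    also have "\<dots> = (\<Sum>l = 1..k. (\<Sum>i\<le>k. \<alpha> i * x i l) * b l (n j))"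
      by (subst sum.swap) (simp add: sum_distrib_right)
    also have "\<dots> = 0" using \<alpha>(2) by simp
    finally show ?thesis .
  qed
  \<comment> \<open>In column j only the diagonal entry survives: \<alpha> vanishes below it and M above it.\<close>
  define j where "j = Max {i. i \<le> k \<and> \<alpha> i \<noteq> 0}"
  have fin: "finite {i. i \<le> k \<and> \<alpha> i \<noteq> 0}" by simp
  have j: "j \<le> k" "\<alpha> j \<noteq> 0" using Max_in[OF fin] \<alpha>(1) unfolding j_def by blast+
  have above: "\<alpha> i = 0" if "i \<le> k" "i > j" for i
    using Max_ge[OF fin, of i] that unfolding j_def by fastforce
  have "(\<Sum>i\<le>k. \<alpha> i * M i j) = (\<Sum>i\<in>{j}. \<alpha> i * M i j)"
  proof (rule sum.mono_neutral_right)
    show "\<forall>i\<in>{..k} - {j}. \<alpha> i * M i j = 0"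
    proof
      fix i assume i: "i \<in> {..k} - {j}"
      show "\<alpha> i * M i j = 0"
      proof (cases "i < j")
        case True
        then show ?thesis using pn(4)[OF j(1)] by (simp add: M_def)
      next
        case False
        then show ?thesis using above i by auto
      qed
    qed
  qed (use j in auto)
  then have "\<alpha> j * M j j = 0" using rel[OF j(1)] by simp
  then show False using j pn(5)[OF j(1)] by (simp add: M_def)
qed

end
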